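(* Let $N\ge2$, and let $m=\sum_{j=1}^Nz_j\rho_j$ be the total electrical charge. Then the PNPF system (stated in the context) can be rewritten in the following form (with $\mathrm u_i$, $1\le i\le N$, eliminated by means of $\nu_i\rho_i(\mathrm u_i-\mathrm u_0)=-k_B\nabla(\rho_iT)-z_i\rho_i\nabla\phi$): $$\partial_t\rho_i+\mathrm u_0\cdot\nabla\rho_i-\tfrac{k_B}{\nu_i}\Delta(\rho_iT)-\nabla\cdot\big(\tfrac{z_i}{\nu_i}\rho_i\nabla\phi\big)=0,\quad i=1,\dots,N,$$ $$-\Delta\phi=\tfrac1\varepsilon m,$$ $$\lambda_0\Delta\mathrm u_0=\nabla P_0+\sum_{i=1}^Nk_B\nabla(\rho_iT)+m\nabla\phi,\qquad\nabla\cdot\mathrm u_0=0,$$ $$\begin{aligned}&\Big(\sum_{i=0}^Nk_Bc_i\rho_i\Big)\partial_tT-k\Delta T+\sum_{i=0}^Nk_Bc_i\rho_i\mathrm u_0\cdot\nabla T-\sum_{i=1}^N\tfrac{k_B^2c_i}{\nu_i}\nabla(\rho_iT)\cdot\nabla T\\&=\lambda_0|\nabla\mathrm u_0|^2+\sum_{i=1}^N\tfrac1{\nu_i\rho_i}\big|k_B\nabla(\rho_iT)+z_i\rho_i\nabla\phi\big|^2+\sum_{i=1}^N\tfrac{k_Bc_iz_i}{\nu_i}\rho_i\nabla\phi\cdot\nabla T\\&\quad+\sum_{i=1}^N\Big(\tfrac{k_B^2}{\nu_i}\Delta(\rho_iT)-\tfrac{k_B^2}{\nu_i\rho_i}\nabla\rho_i\cdot\nabla(\rho_iT)-\tfrac{k_Bz_i}{\varepsilon\nu_i}\rho_im\Big)T,\end{aligned}$$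 $$\partial_tm+\mathrm u_0\cdot\nabla m-\tfrac{k_B}\nu\Delta(mT)=\sum_{i=1}^N\tfrac{z_i^2}{\nu_i}\nabla\cdot(\rho_i\nabla\phi)+k_B\sum_{i=1}^N\big(\tfrac1{\nu_i}-\tfrac1\nu\big)z_i\Delta(\rho_iT),$$ where $\nu=N/\sum_{j=1}^N\frac1{\nu_j}$. Furthermore, if $\rho_i=\delta_i+n_i$ $(1\le i\le N)$ and $T=1+\theta$, where $\delta_i>0$ are arbitrarily fixed constants with $\sum_{j=1}^Nz_j\delta_j=0$, then $(n_1,\dots,n_N,\theta,m,\phi,\mathrm u_0,P_0)$ satisfies $$\partial_tn_i-\tfrac{k_B}{\nu_i}\Delta n_i=\tfrac{k_B\delta_i}{\nu_i}\Delta\theta+\tfrac{z_i\delta_i}{\nu_i}\Delta\phi+R_{n_i},\quad i=1,\dots,N,\qquad -\Delta\phi=\tfrac1\varepsilon m,$$ $$\lambda_0\Delta\mathrm u_0=\nabla P_0+\sum_{i=1}^Nk_B\nabla(n_i+\delta_i\theta)+R_{\mathrm u_0},\qquad\nabla\cdot\mathrm u_0=0,$$ $$a\partial_t\theta-b\Delta\theta=\sum_{i=1}^N\tfrac{k_B^2}{\nu_i}\Delta n_i+\sum_{i=1}^N\tfrac{k_Bz_i\delta_i}{\nu_i}\Delta\phi+R_\theta,$$ $$\partial_tm-\tfrac{k_B}\nu\Delta m+\tfrac1\varepsilon\Big(\sum_{i=1}^N\tfrac{z_i^2\delta_i}{\nu_i}\Big)m=k_B\sum_{i=1}^N\big(\tfrac1{\nu_i}-\tfrac1\nu\big)z_i\Delta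 n_i+k_B\sum_{i=1}^N\tfrac{z_i\delta_i}{\nu_i}\Delta\theta+R_m,$$ where $a,b,R_{n_i},R_{\mathrm u_0},R_\theta,R_m$ are the expressions given in the context.
   Context: Functions are of $(t,x)\in\mathbb R^+\times\mathbb R^3$, sufficiently smooth, with $\rho_i>0$. Coefficients: $z_1\le\cdots\le z_l<0<z_{l+1}\le\cdots\le z_N$ for some $1\le l\le N-1$, and $k_B,\nu_i,k,\varepsilon,\lambda_0,\rho_0,c_0,c_i>0$ ($\rho_0$ is a constant). **PNPF system** for scalar $\rho_i$ $(1\le i\le N)$, $T$, $\phi$, $P_0$ and vector fields $\mathrm u_0,\dots,\mathrm u_N$ in $\mathbb R^3$; for $i=1,\dots,N$: $$\partial_t\rho_i+\nabla\cdot(\rho_i\mathrm u_i)=0,\qquad \nu_i\rho_i(\mathrm u_i-\mathrm u_0)=-k_B\nabla(\rho_iT)-z_i\rho_i\nabla\phi,$$ $$-\varepsilon\Delta\phi=\sum_{j=1}^Nz_j\rho_j,\qquad\lim_{|x|\to+\infty}\phi=0,$$ $$\Big(\sum_{i=0}^Nk_Bc_i\rho_i\Big)\partial_tT+\Big(\sum_{i=0}^Nk_Bc_i\rho_i\mathrm u_i\Big)\cdot\nabla T+\Big(\sum_{i=1}^Nk_B\rho_i\nabla\cdot\mathrm u_i\Big)T=k\Delta T+\lambda_0|\nabla\mathrm u_0|^2+\sum_{i=1}^N\nu_i\rho_i|\mathrm u_i-\mathrm u_0|^2,$$ $$\lambda_0\Delta\mathrm u_0=\nabla P_0+\sum_{i=1}^N\nu_i\rho_i(\mathrm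 u_0-\mathrm u_i),\qquad\lim_{|x|\to+\infty}\mathrm u_0=0,\qquad\nabla\cdot\mathrm u_0=0.$$ **Expressions in the perturbed system:** $$a=k_Bc_0\rho_0+\sum_{i=1}^Nk_Bc_i\delta_i,\qquad b=k+\sum_{i=1}^N\frac{k_B^2\delta_i}{\nu_i},$$ $$R_{n_i}=R_{n_i}(n_i,m,\phi,\mathrm u_0)=-\mathrm u_0\cdot\nabla n_i-\tfrac{z_i}{\varepsilon\nu_i}n_im+\tfrac{z_i}{\nu_i}\nabla n_i\cdot\nabla\phi,\qquad R_{\mathrm u_0}=\sum_{i=1}^Nk_B\nabla(n_i\theta)+m\nabla\phi,$$ $$R_m=-\mathrm u_0\cdot\nabla m+k_B\sum_{i=1}^N\tfrac{z_i}{\nu_i}\Delta(n_i\theta)-\tfrac1\varepsilon\sum_{i=1}^N\tfrac{z_i^2}{\nu_i}n_im+\sum_{i=1}^N\tfrac{z_i^2}{\nu_i}\nabla n_i\cdot\nabla\phi,$$ $$R_\theta=-a\mathrm u_0\cdot\nabla\theta+\frac{aR_\theta^\star}{a+\sum_ik_Bc_in_i}-\frac{\sum_ik_Bc_in_i}{a+\sum_ik_Bc_in_i}\Big(b\Delta\theta+\sum_{i=1}^N\tfrac{k_B^2}{\nu_i}\Delta n_i-\sum_{i=1}^N\tfrac{k_Bz_i\delta_i}{\varepsilon\nu_i}m\Big),$$ $$\begin{aligned}R_\theta^\star=&\sum_{i=1}^N\tfrac{k_B^2c_i}{\nu_i}\nabla(n_i+\delta_i\theta+n_i\theta)\cdot\nabla\theta+\sum_{i=1}^N\tfrac{k_Bc_iz_i}{\nu_i}(\delta_i+n_i)\nabla\phi\cdot\nabla\theta+\sum_{i=1}^N\tfrac{k_B^2}{\nu_i}\Delta(n_i\theta)-\sum_{i=1}^N\tfrac{k_Bz_i}{\varepsilon\nu_i}n_im\\&-\sum_{i=1}^N\tfrac{k_B^2}{\nu_i(\delta_i+n_i)}(1+\theta)\nabla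 n_i\cdot\nabla(n_i+\delta_i\theta+n_i\theta)+\sum_{i=1}^N\tfrac{k_B^2}{\nu_i}\Delta(n_i+\delta_i\theta+n_i\theta)\,\theta-\sum_{i=1}^N\tfrac{k_Bz_i}{\varepsilon\nu_i}(\delta_i+n_i)m\theta\\&+\lambda_0|\nabla\mathrm u_0|^2+\sum_{i=1}^N\tfrac1{\nu_i(\delta_i+n_i)}\big|k_B\nabla(n_i+\delta_i\theta+n_i\theta)+z_i(\delta_i+n_i)\nabla\phi\big|^2.\end{aligned}$$
   Formalization: The expression R_{n_i} is corrected by adding the term (k_B/ν_i)Δ(n_iθ), which the printed formula omits; without it the equation for n_i fails in general, although the printed R_m does contain the corresponding term. *)

theory Defs
  imports "HOL-Analysis.Analysis"
begin

type_synonym scalar_field = "real ^ 3 \<Rightarrow> real"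
type_synonym vector_field = "real ^ 3 \<Rightarrow> real ^ 3"

section \<open>Differential operators\<close>

definition partial :: "3 \<Rightarrow> scalar_field \<Rightarrow> scalar_field" where
  "partial j f x = frechet_derivative f (at x) (axis j 1)"

definition grad :: "scalar_field \<Rightarrow> vector_field" where
  "grad f x = (\<chi> j. partial j f x)"

definition divergence :: "vector_field \<Rightarrow> scalar_field" where
  "divergence v x = (\<Sum>j\<in>UNIV. partial j (\<lambda>y. v y $ j) x)"

definition laplacian :: "scalar_field \<Rightarrow> scalar_field" where
  "laplacian f x = (\<Sum>j\<in>UNIV. partial j (partial j f) x)"

definition vec_laplacian :: "vector_field \<Rightarrow> vector_field" where
  "vec_laplacian v x = (\<chi> j. laplacian (\<lambda>y. v y $ j) x)"

text \<open>The squared Frobenius norm of the Jacobian of \<open>v\<close>.\<close>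

definition grad_norm_sq :: "vector_field \<Rightarrow> scalar_field" where
  "grad_norm_sq v x = (\<Sum>i\<in>UNIV. \<Sum>j\<in>UNIV. (partial i (\<lambda>y. v y $ j) x)\<^sup>2)"

definition time_deriv :: "(real \<Rightarrow> scalar_field) \<Rightarrow> real \<Rightarrow> scalar_field" where
  "time_deriv f t x = deriv (\<lambda>s. f s x) t"

section \<open>Regularity and coefficients\<close>

text \<open>
  Fields are total functions of a time in \<open>real\<close> and a point; only times \<open>t > 0\<close> are ever
  constrained. The regularity below is the least for which every derivative in the system
  (in the friction law, also after inserting it into the other equations) exists classically;
  it is implied by every usual reading of ``sufficiently smooth''.
\<close>

definition twice_differentiable :: "scalar_field \<Rightarrow> bool" where
  "twice_differentiable f \<longleftrightarrow> f differentiable_on UNIV \<and> grad f differentiable_on UNIV"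

definition sufficiently_smooth ::
  "nat \<Rightarrow> (nat \<Rightarrow> real \<Rightarrow> scalar_field) \<Rightarrow> (real \<Rightarrow> scalar_field) \<Rightarrow> (real \<Rightarrow> scalar_field) \<Rightarrow>
   (real \<Rightarrow> scalar_field) \<Rightarrow> (nat \<Rightarrow> real \<Rightarrow> vector_field) \<Rightarrow> bool" where
  "sufficiently_smooth N \<rho> T \<phi> P u \<longleftrightarrow> (\<forall>t>0.
     (\<forall>i\<in>{1..N}. twice_differentiable (\<rho> i t) \<and> (\<forall>x. (\<lambda>s. \<rho> i s x) differentiable (at t))) \<and>
     twice_differentiable (T t) \<and> (\<forall>x. (\<lambda>s. T s x) differentiable (at t)) \<and>
     twice_differentiable (\<phi> t) \<and>
     P t differentiable_on UNIV \<and>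
     (\<forall>j. twice_differentiable (\<lambda>x. u 0 t x $ j)) \<and>
     (\<forall>i\<in>{1..N}. u i t differentiable_on UNIV))"

text \<open>Only \<open>z i\<close> and \<open>\<nu> i\<close> with \<open>1 \<le> i \<le> N\<close> and \<open>c i\<close> with \<open>0 \<le> i \<le> N\<close> are meaningful.\<close>

definition admissible_coefficients ::
  "nat \<Rightarrow> nat \<Rightarrow> real \<Rightarrow> real \<Rightarrow> real \<Rightarrow> real \<Rightarrow> real \<Rightarrow>
   (nat \<Rightarrow> real) \<Rightarrow> (nat \<Rightarrow> real) \<Rightarrow> (nat \<Rightarrow> real) \<Rightarrow> bool" where
  "admissible_coefficients N l kB k \<epsilon> lam \<rho>0 c \<nu> z \<longleftrightarrow>
     1 \<le> l \<and> l \<le> N - 1 \<and> mono_on {1..N} z \<and> z l < 0 \<and> 0 < z (l + 1) \<and>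
     0 < kB \<and> 0 < k \<and> 0 < \<epsilon> \<and> 0 < lam \<and> 0 < \<rho>0 \<and>
     (\<forall>i\<in>{0..N}. 0 < c i) \<and> (\<forall>i\<in>{1..N}. 0 < \<nu> i)"

section \<open>The PNPF system\<close>

definition friction_law ::
  "nat \<Rightarrow> real \<Rightarrow> (nat \<Rightarrow> real) \<Rightarrow> (nat \<Rightarrow> real) \<Rightarrow> (nat \<Rightarrow> real \<Rightarrow> scalar_field) \<Rightarrow>
   (real \<Rightarrow> scalar_field) \<Rightarrow> (real \<Rightarrow> scalar_field) \<Rightarrow> (nat \<Rightarrow> real \<Rightarrow> vector_field) \<Rightarrow> bool" where
  "friction_law N kB \<nu> z \<rho> T \<phi> u \<longleftrightarrow> (\<forall>t>0. \<forall>x. \<forall>i\<in>{1..N}.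
     (\<nu> i * \<rho> i t x) *\<^sub>R (u i t x - u 0 t x) =
       - (kB *\<^sub>R grad (\<lambda>y. \<rho> i t y * T t y) x) - (z i * \<rho> i t x) *\<^sub>R grad (\<phi> t) x)"

definition far_field :: "(real \<Rightarrow> scalar_field) \<Rightarrow> (real \<Rightarrow> vector_field) \<Rightarrow> bool" where
  "far_field \<phi> u0 \<longleftrightarrow> (\<forall>t>0. (\<phi> t \<longlongrightarrow> 0) at_infinity \<and> (u0 t \<longlongrightarrow> 0) at_infinity)"

text \<open>\<open>\<rho> 0\<close> and \<open>u 0\<close> are the density and velocity of the solvent.\<close>

definition pnpf_system ::
  "nat \<Rightarrow> real \<Rightarrow> real \<Rightarrow> real \<Rightarrow> real \<Rightarrow> (nat \<Rightarrow> real) \<Rightarrow> (nat \<Rightarrow> real) \<Rightarrow> (nat \<Rightarrow> real) \<Rightarrow>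
   (nat \<Rightarrow> real \<Rightarrow> scalar_field) \<Rightarrow> (real \<Rightarrow> scalar_field) \<Rightarrow> (real \<Rightarrow> scalar_field) \<Rightarrow>
   (real \<Rightarrow> scalar_field) \<Rightarrow> (nat \<Rightarrow> real \<Rightarrow> vector_field) \<Rightarrow> bool" where
  "pnpf_system N kB k \<epsilon> lam c \<nu> z \<rho> T \<phi> P u \<longleftrightarrow>
     friction_law N kB \<nu> z \<rho> T \<phi> u \<and> far_field \<phi> (u 0) \<and>
     (\<forall>t>0. \<forall>x.
       (\<forall>i\<in>{1..N}. time_deriv (\<rho> i) t x + divergence (\<lambda>y. \<rho> i t y *\<^sub>R u i t y) x = 0) \<and>
       - \<epsilon> * laplacian (\<phi> t) x = (\<Sum>j=1..N. z j * \<rho> j t x) \<and>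
       (\<Sum>i=0..N. kB * c i * \<rho> i t x) * time_deriv T t x
         + (\<Sum>i=0..N. (kB * c i * \<rho> i t x) *\<^sub>R u i t x) \<bullet> grad (T t) x
         + (\<Sum>i=1..N. kB * \<rho> i t x * divergence (u i t) x) * T t x
         = k * laplacian (T t) x + lam * grad_norm_sq (u 0 t) x
           + (\<Sum>i=1..N. \<nu> i * \<rho> i t x * (norm (u i t x - u 0 t x))\<^sup>2) \<and>
       lam *\<^sub>R vec_laplacian (u 0 t) x
         = grad (P t) x + (\<Sum>i=1..N. (\<nu> i * \<rho> i t x) *\<^sub>R (u 0 t x - u i t x)) \<and>
       divergence (u 0 t) x = 0)"

section \<open>The system with the ion velocities eliminated\<close>

definition mean_friction :: "nat \<Rightarrow> (nat \<Rightarrow> real) \<Rightarrow> real" where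
  "mean_friction N \<nu> = real N / (\<Sum>j=1..N. 1 / \<nu> j)"

definition reduced_system ::
  "nat \<Rightarrow> real \<Rightarrow> real \<Rightarrow> real \<Rightarrow> real \<Rightarrow> (nat \<Rightarrow> real) \<Rightarrow> (nat \<Rightarrow> real) \<Rightarrow> (nat \<Rightarrow> real) \<Rightarrow>
   (nat \<Rightarrow> real \<Rightarrow> scalar_field) \<Rightarrow> (real \<Rightarrow> scalar_field) \<Rightarrow> (real \<Rightarrow> scalar_field) \<Rightarrow>
   (real \<Rightarrow> scalar_field) \<Rightarrow> (real \<Rightarrow> scalar_field) \<Rightarrow> (real \<Rightarrow> vector_field) \<Rightarrow> bool" where
  "reduced_system N kB k \<epsilon> lam c \<nu> z \<rho> T m \<phi> P u0 \<longleftrightarrow> (\<forall>t>0. \<forall>x.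
     (\<forall>i\<in>{1..N}.
       time_deriv (\<rho> i) t x + u0 t x \<bullet> grad (\<rho> i t) x
         - kB / \<nu> i * laplacian (\<lambda>y. \<rho> i t y * T t y) x
         - divergence (\<lambda>y. (z i / \<nu> i * \<rho> i t y) *\<^sub>R grad (\<phi> t) y) x = 0) \<and>
     - laplacian (\<phi> t) x = 1 / \<epsilon> * m t x \<and>
     lam *\<^sub>R vec_laplacian (u0 t) x
       = grad (P t) x + (\<Sum>i=1..N. kB *\<^sub>R grad (\<lambda>y. \<rho> i t y * T t y) x)
         + m t x *\<^sub>R grad (\<phi> t) x \<and>
     divergence (u0 t) x = 0 \<and>
     (\<Sum>i=0..N. kB * c i * \<rho> i t x) * time_deriv T t x - k * laplacian (T t) x
       + (\<Sum>i=0..N. kB * c i * \<rho> i t x * (u0 t x \<bullet> grad (T t) x))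
       - (\<Sum>i=1..N. kB\<^sup>2 * c i / \<nu> i * (grad (\<lambda>y. \<rho> i t y * T t y) x \<bullet> grad (T t) x))
       = lam * grad_norm_sq (u0 t) x
         + (\<Sum>i=1..N. 1 / (\<nu> i * \<rho> i t x) *
             (norm (kB *\<^sub>R grad (\<lambda>y. \<rho> i t y * T t y) x
                    + (z i * \<rho> i t x) *\<^sub>R grad (\<phi> t) x))\<^sup>2)
         + (\<Sum>i=1..N. kB * c i * z i / \<nu> i * \<rho> i t x * (grad (\<phi> t) x \<bullet> grad (T t) x))
         + (\<Sum>i=1..N. kB\<^sup>2 / \<nu> i * laplacian (\<lambda>y. \<rho> i t y * T t y) x
             - kB\<^sup>2 / (\<nu> i * \<rho> i t x) * (grad (\<rho> i t) x \<bullet> grad (\<lambda>y. \<rho> i t y * T t y) x)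
             - kB * z i / (\<epsilon> * \<nu> i) * \<rho> i t x * m t x) * T t x \<and>
     time_deriv m t x + u0 t x \<bullet> grad (m t) x
       - kB / mean_friction N \<nu> * laplacian (\<lambda>y. m t y * T t y) x
       = (\<Sum>i=1..N. (z i)\<^sup>2 / \<nu> i * divergence (\<lambda>y. \<rho> i t y *\<^sub>R grad (\<phi> t) y) x)
         + kB * (\<Sum>i=1..N. (1 / \<nu> i - 1 / mean_friction N \<nu>) * z i
                    * laplacian (\<lambda>y. \<rho> i t y * T t y) x))"

section \<open>The perturbed system\<close>

text \<open>In this section the fields \<open>n i\<close>, \<open>\<theta>\<close>, \<open>m\<close>, \<open>\<phi>\<close>, \<open>u0\<close> in the remainders are time slices.\<close>

definition coeff_a :: "nat \<Rightarrow> real \<Rightarrow> real \<Rightarrow> (nat \<Rightarrow> real) \<Rightarrow> (nat \<Rightarrow> real) \<Rightarrow> real" where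
  "coeff_a N kB \<rho>0 c \<delta> = kB * c 0 * \<rho>0 + (\<Sum>i=1..N. kB * c i * \<delta> i)"

definition coeff_b :: "nat \<Rightarrow> real \<Rightarrow> real \<Rightarrow> (nat \<Rightarrow> real) \<Rightarrow> (nat \<Rightarrow> real) \<Rightarrow> real" where
  "coeff_b N kB k \<nu> \<delta> = k + (\<Sum>i=1..N. kB\<^sup>2 * \<delta> i / \<nu> i)"

text \<open>
  The last summand, \<open>kB / \<nu> i * laplacian (n i * \<theta>)\<close>, comes from expanding
  \<open>laplacian (\<rho> i * T)\<close> with \<open>\<rho> i * T = \<delta> i + n i + \<delta> i * \<theta> + n i * \<theta>\<close>. It is missing from the
  source's formula for \<open>R_n\<close>, with which the equation for \<open>n i\<close> fails in general; the
  source's \<open>R_m\<close>, which equals \<open>\<Sum>i. z i * R_n i\<close>, does contain it.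
\<close>

definition R_n ::
  "real \<Rightarrow> real \<Rightarrow> (nat \<Rightarrow> real) \<Rightarrow> (nat \<Rightarrow> real) \<Rightarrow> nat \<Rightarrow> (nat \<Rightarrow> scalar_field) \<Rightarrow> scalar_field \<Rightarrow>
   scalar_field \<Rightarrow> scalar_field \<Rightarrow> vector_field \<Rightarrow> scalar_field" where
  "R_n kB \<epsilon> \<nu> z i n \<theta> m \<phi> u0 x =
     - (u0 x \<bullet> grad (n i) x) - z i / (\<epsilon> * \<nu> i) * n i x * m x
     + z i / \<nu> i * (grad (n i) x \<bullet> grad \<phi> x)
     + kB / \<nu> i * laplacian (\<lambda>y. n i y * \<theta> y) x"

definition R_u ::
  "nat \<Rightarrow> real \<Rightarrow> (nat \<Rightarrow> scalar_field) \<Rightarrow> scalar_field \<Rightarrow> scalar_field \<Rightarrow> scalar_field \<Rightarrow>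
   vector_field" where
  "R_u N kB n \<theta> m \<phi> x =
     (\<Sum>i=1..N. kB *\<^sub>R grad (\<lambda>y. n i y * \<theta> y) x) + m x *\<^sub>R grad \<phi> x"

definition R_m ::
  "nat \<Rightarrow> real \<Rightarrow> real \<Rightarrow> (nat \<Rightarrow> real) \<Rightarrow> (nat \<Rightarrow> real) \<Rightarrow> (nat \<Rightarrow> scalar_field) \<Rightarrow> scalar_field \<Rightarrow>
   scalar_field \<Rightarrow> scalar_field \<Rightarrow> vector_field \<Rightarrow> scalar_field" where
  "R_m N kB \<epsilon> \<nu> z n \<theta> m \<phi> u0 x =
     - (u0 x \<bullet> grad m x)
     + kB * (\<Sum>i=1..N. z i / \<nu> i * laplacian (\<lambda>y. n i y * \<theta> y) x)
     - 1 / \<epsilon> * (\<Sum>i=1..N. (z i)\<^sup>2 / \<nu> i * n i x * m x)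
     + (\<Sum>i=1..N. (z i)\<^sup>2 / \<nu> i * (grad (n i) x \<bullet> grad \<phi> x))"

definition R_theta_star ::
  "nat \<Rightarrow> real \<Rightarrow> real \<Rightarrow> real \<Rightarrow> (nat \<Rightarrow> real) \<Rightarrow> (nat \<Rightarrow> real) \<Rightarrow> (nat \<Rightarrow> real) \<Rightarrow> (nat \<Rightarrow> real) \<Rightarrow>
   (nat \<Rightarrow> scalar_field) \<Rightarrow> scalar_field \<Rightarrow> scalar_field \<Rightarrow> scalar_field \<Rightarrow> vector_field \<Rightarrow>
   scalar_field" where
  "R_theta_star N kB \<epsilon> lam c \<nu> z \<delta> n \<theta> m \<phi> u0 x =
     (let q = (\<lambda>i y. n i y + \<delta> i * \<theta> y + n i y * \<theta> y) in
       (\<Sum>i=1..N. kB\<^sup>2 * c i / \<nu> i * (grad (q i) x \<bullet> grad \<theta> x))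
     + (\<Sum>i=1..N. kB * c i * z i / \<nu> i * (\<delta> i + n i x) * (grad \<phi> x \<bullet> grad \<theta> x))
     + (\<Sum>i=1..N. kB\<^sup>2 / \<nu> i * laplacian (\<lambda>y. n i y * \<theta> y) x)
     - (\<Sum>i=1..N. kB * z i / (\<epsilon> * \<nu> i) * n i x * m x)
     - (\<Sum>i=1..N. kB\<^sup>2 / (\<nu> i * (\<delta> i + n i x)) * (1 + \<theta> x) * (grad (n i) x \<bullet> grad (q i) x))
     + (\<Sum>i=1..N. kB\<^sup>2 / \<nu> i * laplacian (q i) x * \<theta> x)
     - (\<Sum>i=1..N. kB * z i / (\<epsilon> * \<nu> i) * (\<delta> i + n i x) * m x * \<theta> x)
     + lam * grad_norm_sq u0 x
     + (\<Sum>i=1..N. 1 / (\<nu> i * (\<delta> i + n i x)) *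
         (norm (kB *\<^sub>R grad (q i) x + (z i * (\<delta> i + n i x)) *\<^sub>R grad \<phi> x))\<^sup>2))"

definition R_theta ::
  "nat \<Rightarrow> real \<Rightarrow> real \<Rightarrow> real \<Rightarrow> real \<Rightarrow> real \<Rightarrow> (nat \<Rightarrow> real) \<Rightarrow> (nat \<Rightarrow> real) \<Rightarrow> (nat \<Rightarrow> real) \<Rightarrow>
   (nat \<Rightarrow> real) \<Rightarrow> (nat \<Rightarrow> scalar_field) \<Rightarrow> scalar_field \<Rightarrow> scalar_field \<Rightarrow> scalar_field \<Rightarrow>
   vector_field \<Rightarrow> scalar_field" where
  "R_theta N kB k \<epsilon> lam \<rho>0 c \<nu> z \<delta> n \<theta> m \<phi> u0 x =
     (let a = coeff_a N kB \<rho>0 c \<delta>;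
          b = coeff_b N kB k \<nu> \<delta>;
          s = (\<Sum>i=1..N. kB * c i * n i x) in
       - (a * (u0 x \<bullet> grad \<theta> x))
       + a * R_theta_star N kB \<epsilon> lam c \<nu> z \<delta> n \<theta> m \<phi> u0 x / (a + s)
       - s / (a + s) *
         (b * laplacian \<theta> x + (\<Sum>i=1..N. kB\<^sup>2 / \<nu> i * laplacian (n i) x)
          - (\<Sum>i=1..N. kB * z i * \<delta> i / (\<epsilon> * \<nu> i) * m x)))"

definition perturbed_system ::
  "nat \<Rightarrow> real \<Rightarrow> real \<Rightarrow> real \<Rightarrow> real \<Rightarrow> real \<Rightarrow> (nat \<Rightarrow> real) \<Rightarrow> (nat \<Rightarrow> real) \<Rightarrow> (nat \<Rightarrow> real) \<Rightarrow>
   (nat \<Rightarrow> real) \<Rightarrow> (nat \<Rightarrow> real \<Rightarrow> scalar_field) \<Rightarrow> (real \<Rightarrow> scalar_field) \<Rightarrow>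
   (real \<Rightarrow> scalar_field) \<Rightarrow> (real \<Rightarrow> scalar_field) \<Rightarrow> (real \<Rightarrow> vector_field) \<Rightarrow>
   (real \<Rightarrow> scalar_field) \<Rightarrow> bool" where
  "perturbed_system N kB k \<epsilon> lam \<rho>0 c \<nu> z \<delta> n \<theta> m \<phi> u0 P \<longleftrightarrow> (\<forall>t>0. \<forall>x.
     (\<forall>i\<in>{1..N}.
       time_deriv (n i) t x - kB / \<nu> i * laplacian (n i t) x
         = kB * \<delta> i / \<nu> i * laplacian (\<theta> t) x + z i * \<delta> i / \<nu> i * laplacian (\<phi> t) x
           + R_n kB \<epsilon> \<nu> z i (\<lambda>j. n j t) (\<theta> t) (m t) (\<phi> t) (u0 t) x) \<and>
     - laplacian (\<phi> t) x = 1 / \<epsilon> * m t x \<and>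
     lam *\<^sub>R vec_laplacian (u0 t) x
       = grad (P t) x + (\<Sum>i=1..N. kB *\<^sub>R grad (\<lambda>y. n i t y + \<delta> i * \<theta> t y) x)
         + R_u N kB (\<lambda>j. n j t) (\<theta> t) (m t) (\<phi> t) x \<and>
     divergence (u0 t) x = 0 \<and>
     coeff_a N kB \<rho>0 c \<delta> * time_deriv \<theta> t x - coeff_b N kB k \<nu> \<delta> * laplacian (\<theta> t) x
       = (\<Sum>i=1..N. kB\<^sup>2 / \<nu> i * laplacian (n i t) x)
         + (\<Sum>i=1..N. kB * z i * \<delta> i / \<nu> i * laplacian (\<phi> t) x)
         + R_theta N kB k \<epsilon> lam \<rho>0 c \<nu> z \<delta> (\<lambda>j. n j t) (\<theta> t) (m t) (\<phi> t) (u0 t) x \<and>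
     time_deriv m t x - kB / mean_friction N \<nu> * laplacian (m t) x
       + 1 / \<epsilon> * (\<Sum>i=1..N. (z i)\<^sup>2 * \<delta> i / \<nu> i) * m t x
       = kB * (\<Sum>i=1..N. (1 / \<nu> i - 1 / mean_friction N \<nu>) * z i * laplacian (n i t) x)
         + kB * (\<Sum>i=1..N. z i * \<delta> i / \<nu> i * laplacian (\<theta> t) x)
         + R_m N kB \<epsilon> \<nu> z (\<lambda>j. n j t) (\<theta> t) (m t) (\<phi> t) (u0 t) x)"

end

(*
  The friction law expresses the flux rho_i u_i through u_0, grad (rho_i T) and grad phi. Its
  divergence turns the continuity equation into the density equation, and combining it with
  rho_i div u_i = div (rho_i u_i) - u_i . grad rho_i gives the compression work in the heat
  equation, where the Poisson equation replaces Laplace phi by - m / eps. The z_i-weighted sum of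
  the density equations is the charge equation. For the perturbed system every term is expanded
  with rho_i T = delta_i + (n_i + delta_i theta + n_i theta); the heat equation then reads
  (a + s) (d_t theta + u_0 . grad theta) = L + R_theta_star with s the sum of the k_B c_i n_i, and
  a / (a + s) = 1 - s / (a + s).
*)
theory Submission
  imports Defs
begin

text \<open>The equivalence is proved equation by equation and point by point, but the equations are
  not independent: the density equation changes form only where
  \<open>divergence (u 0 t) x = 0\<close>, and the heat equation needs the Poisson equation as well.
  Both conditions occur on either side, so they are available in both directions. The ion velocities
  do not occur in the reduced system, which is why the friction law has to stay beside it; the
  charge equation is a consequence of the density equations and is simply dropped in the converse
  direction. The mean friction in the charge equation is a way of splitting the diffusion:
  \<Delta>(m T) is the sum of the z_i \<Delta>(rho_i T), so whatever multiple of it is subtracted on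
  the left is also subtracted on the right. In the perturbed system, neutrality of the \<delta>_i
  makes m the z_i-weighted sum of the n_i alone, so that m is itself a perturbation.\<close>

lemma has_derivative_imp_partial:
  assumes "(f has_derivative f') (at x)"
  shows "partial j f x = f' (axis j 1)"
  using frechet_derivative_at[OF assms] by (simp add: partial_def)

lemma differentiable_vec_nth:
  fixes v :: vector_field
  assumes "v differentiable (at x)"
  shows "(\<lambda>y. v y $ j) differentiable (at x)"
  using assms unfolding differentiable_def
  by (blast intro: bounded_linear.has_derivative[OF bounded_linear_vec_nth])

text \<open>Needed for the solvent velocity, whose regularity is assumed component by component,
  while the rules for \<open>divergence\<close> ask for a differentiable vector field.\<close>

lemma differentiable_componentwise:
  fixes v :: vector_field
  assumes "\<And>j. (\<lambda>y. v y $ j) differentiable (at x)"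
  shows "v differentiable (at x)"
  using assms by (subst differentiable_componentwise_within)
    (auto simp: Basis_vec_def inner_axis)

section \<open>Sum and product rules for partial derivatives, gradient and divergence\<close>

lemma partial_add:
  assumes "f differentiable (at x)" "g differentiable (at x)"
  shows "partial j (\<lambda>y. f y + g y) x = partial j f x + partial j g x"
  using has_derivative_imp_partial[OF has_derivative_add[OF
    assms(1)[unfolded frechet_derivative_works] assms(2)[unfolded frechet_derivative_works]]]
  by (simp add: partial_def)

lemma partial_mult:
  assumes "f differentiable (at x)" "g differentiable (at x)"
  shows "partial j (\<lambda>y. f y * g y) x = f x * partial j g x + partial j f x * g x"
  using has_derivative_imp_partial[OF has_derivative_mult[OF
    assms(1)[unfolded frechet_derivative_works] assms(2)[unfolded frechet_derivative_works]]]
  by (simp add: partial_def)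

lemma partial_const: "partial j (\<lambda>_. a) x = 0"
  using has_derivative_imp_partial[OF has_derivative_const] by simp

lemma grad_const: "grad (\<lambda>_. a) x = 0"
  by (simp add: grad_def partial_const vec_eq_iff)

lemma grad_add:
  assumes "f differentiable (at x)" "g differentiable (at x)"
  shows "grad (\<lambda>y. f y + g y) x = grad f x + grad g x"
  by (simp add: grad_def partial_add[OF assms] vec_eq_iff)

lemma grad_mult:
  assumes "f differentiable (at x)" "g differentiable (at x)"
  shows "grad (\<lambda>y. f y * g y) x = f x *\<^sub>R grad g x + g x *\<^sub>R grad f x"
  by (simp add: grad_def partial_mult[OF assms] vec_eq_iff)

lemma grad_cmult:
  assumes "f differentiable (at x)"
  shows "grad (\<lambda>y. a * f y) x = a *\<^sub>R grad f x"
  using grad_mult[OF differentiable_const assms, of a] by (simp add: grad_const)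

lemma divergence_add:
  assumes "v differentiable (at x)" "w differentiable (at x)"
  shows "divergence (\<lambda>y. v y + w y) x = divergence v x + divergence w x"
  by (simp add: divergence_def partial_add differentiable_vec_nth assms sum.distrib)

lemma divergence_scaleR:
  assumes "f differentiable (at x)" "v differentiable (at x)"
  shows "divergence (\<lambda>y. f y *\<^sub>R v y) x = f x * divergence v x + grad f x \<bullet> v x"
  by (simp add: divergence_def partial_mult differentiable_vec_nth assms sum.distrib
      grad_def inner_vec_def sum_distrib_left)

lemma divergence_cscaleR:
  assumes "v differentiable (at x)"
  shows "divergence (\<lambda>y. a *\<^sub>R v y) x = a * divergence v x"
  using divergence_scaleR[OF differentiable_const assms, of a] by (simp add: grad_const)

section \<open>Twice differentiable fields and the Laplacian\<close>

lemma laplacian_eq_divergence_grad: "laplacian f x = divergence (grad f) x"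
  by (simp add: laplacian_def divergence_def grad_def)

lemma twice_differentiableD:
  assumes "twice_differentiable f"
  shows "f differentiable (at x)" "grad f differentiable (at x)"
  using assms by (auto simp: twice_differentiable_def differentiable_on_def)

lemma twice_differentiable_const: "twice_differentiable (\<lambda>_. a)"
proof -
  have "grad (\<lambda>_. a) = (\<lambda>_. 0)" by (simp add: fun_eq_iff grad_const)
  then show ?thesis by (simp add: twice_differentiable_def)
qed

lemma twice_differentiable_add:
  assumes "twice_differentiable f" "twice_differentiable g"
  shows "twice_differentiable (\<lambda>y. f y + g y)"
proof -
  \<comment> \<open>The identity is needed between functions, not at one point, because the gradient
    is differentiated once more.\<close>
  have "grad (\<lambda>y. f y + g y) = (\<lambda>y. grad f y + grad g y)"
    by (simp add: fun_eq_iff grad_add twice_differentiableD assms)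
  then show ?thesis
    using assms by (simp add: twice_differentiable_def differentiable_on_def)
qed

lemma twice_differentiable_mult:
  assumes "twice_differentiable f" "twice_differentiable g"
  shows "twice_differentiable (\<lambda>y. f y * g y)"
proof -
  have "grad (\<lambda>y. f y * g y) = (\<lambda>y. f y *\<^sub>R grad g y + g y *\<^sub>R grad f y)"
    by (simp add: fun_eq_iff grad_mult twice_differentiableD assms)
  then show ?thesis
    using assms by (simp add: twice_differentiable_def differentiable_on_def)
qed

lemma twice_differentiable_sum:
  assumes "\<And>i. i \<in> I \<Longrightarrow> twice_differentiable (f i)"
  shows "twice_differentiable (\<lambda>y. \<Sum>i\<in>I. f i y)"
  using assms
  by (induction I rule: infinite_finite_induct)
    (simp_all add: twice_differentiable_const twice_differentiable_add)

lemma grad_sum: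
  assumes "\<And>i. i \<in> I \<Longrightarrow> f i differentiable (at x)"
  shows "grad (\<lambda>y. \<Sum>i\<in>I. f i y) x = (\<Sum>i\<in>I. grad (f i) x)"
  using assms
  by (induction I rule: infinite_finite_induct)
    (simp_all add: grad_const grad_add differentiable_sum)

lemma laplacian_const: "laplacian (\<lambda>_. a) x = 0"
proof -
  have "grad (\<lambda>_. a) = (\<lambda>_. 0)" by (simp add: fun_eq_iff grad_const)
  then show ?thesis by (simp add: laplacian_eq_divergence_grad divergence_def partial_const)
qed

lemma laplacian_add:
  assumes "twice_differentiable f" "twice_differentiable g"
  shows "laplacian (\<lambda>y. f y + g y) x = laplacian f x + laplacian g x"
proof -
  have "grad (\<lambda>y. f y + g y) = (\<lambda>y. grad f y + grad g y)"
    by (simp add: fun_eq_iff grad_add twice_differentiableD assms)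
  then show ?thesis
    by (simp add: laplacian_eq_divergence_grad divergence_add twice_differentiableD assms)
qed

lemma laplacian_cmult:
  assumes "twice_differentiable f"
  shows "laplacian (\<lambda>y. a * f y) x = a * laplacian f x"
proof -
  have "grad (\<lambda>y. a * f y) = (\<lambda>y. a *\<^sub>R grad f y)"
    by (simp add: fun_eq_iff grad_cmult twice_differentiableD assms)
  then show ?thesis
    by (simp add: laplacian_eq_divergence_grad divergence_cscaleR twice_differentiableD assms)
qed

lemma laplacian_sum:
  assumes "\<And>i. i \<in> I \<Longrightarrow> twice_differentiable (f i)"
  shows "laplacian (\<lambda>y. \<Sum>i\<in>I. f i y) x = (\<Sum>i\<in>I. laplacian (f i) x)"
  using assms
  by (induction I rule: infinite_finite_induct)
    (simp_all add: laplacian_const laplacian_add twice_differentiable_sum)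

lemma divergence_scaleR_grad:
  assumes "twice_differentiable f" "twice_differentiable g"
  shows "divergence (\<lambda>y. f y *\<^sub>R grad g y) x = f x * laplacian g x + grad f x \<bullet> grad g x"
  by (simp add: divergence_scaleR twice_differentiableD assms laplacian_eq_divergence_grad)

lemma divergence_cmult_scaleR_grad:
  assumes "twice_differentiable f" "twice_differentiable g"
  shows "divergence (\<lambda>y. (a * f y) *\<^sub>R grad g y) x =
    a * (f x * laplacian g x + grad f x \<bullet> grad g x)"
  by (simp add: divergence_scaleR_grad twice_differentiable_mult twice_differentiable_const
      grad_cmult twice_differentiableD assms algebra_simps)

text \<open>Fields are related to each other only at positive times, whereas \<open>deriv\<close>
  looks at functions on the whole line. The positive half-line is open, so agreement there
  determines the derivative at \<open>t\<close>.\<close>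

lemma time_deriv_eqI:
  assumes "((\<lambda>s. g s x) has_field_derivative D) (at t)" "0 < t" "\<And>s. 0 < s \<Longrightarrow> f s x = g s x"
  shows "time_deriv f t x = D"
proof -
  have "((\<lambda>s. f s x) has_field_derivative D) (at t)"
    by (rule has_field_derivative_transform_within_open[OF assms(1), of "{0<..}"])
      (use assms in auto)
  then show ?thesis unfolding time_deriv_def by (rule DERIV_imp_deriv)
qed

lemma has_time_deriv:
  assumes "(\<lambda>s. f s x) differentiable (at t)"
  shows "((\<lambda>s. f s x) has_field_derivative time_deriv f t x) (at t)"
  using assms unfolding time_deriv_def
  by (simp add: DERIV_deriv_iff_real_differentiable)

section \<open>Consequences of the friction law for a single species\<close>

lemma friction_law_flux:
  fixes g p v w :: "'a::real_vector"
  assumes "(\<nu> * r) *\<^sub>R (v - w) = - (kB *\<^sub>R g) - (z * r) *\<^sub>R p" and "\<nu> \<noteq> 0"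
  shows "r *\<^sub>R v = r *\<^sub>R w + ((- kB / \<nu>) *\<^sub>R g + (- z / \<nu> * r) *\<^sub>R p)"
proof -
  \<comment> \<open>Only \<nu> is cancelled and the density stays in front of the velocity, so the
    flux becomes a sum of fields whose divergence can be taken.\<close>
  have "\<nu> *\<^sub>R (r *\<^sub>R (v - w)) = \<nu> *\<^sub>R ((- kB / \<nu>) *\<^sub>R g + (- z / \<nu> * r) *\<^sub>R p)"
    using assms by (simp add: scaleR_diff_right)
  then have "r *\<^sub>R (v - w) = (- kB / \<nu>) *\<^sub>R g + (- z / \<nu> * r) *\<^sub>R p"
    using \<open>\<nu> \<noteq> 0\<close> by (simp only: scaleR_cancel_left) simp
  then show ?thesis by (simp add: scaleR_diff_right diff_eq_eq add.commute)
qed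

text \<open>Applied with \<open>h\<close> the gradient of the density in the compression work and
  with \<open>h\<close> the gradient of the temperature in the convective term.\<close>

lemma friction_law_flux_inner:
  fixes g p v w h :: "'a::real_inner"
  assumes "(\<nu> * r) *\<^sub>R (v - w) = - (kB *\<^sub>R g) - (z * r) *\<^sub>R p" and "\<nu> \<noteq> 0"
  shows "r * (v \<bullet> h) = r * (w \<bullet> h) - kB / \<nu> * (g \<bullet> h) - z / \<nu> * r * (p \<bullet> h)"
  using arg_cong[OF friction_law_flux[OF assms], of "\<lambda>a. a \<bullet> h"]
  by (simp add: inner_add_left inner_diff_left)

text \<open>Up to sign, the vector on the right is \<nu> r (v - w). Its squared norm contains \<nu>
  r squared, and the prefactor removes one of the two factors.\<close>

lemma friction_law_heating:
  fixes g p v w :: "'a::real_inner"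
  assumes "(\<nu> * r) *\<^sub>R (v - w) = - (kB *\<^sub>R g) - (z * r) *\<^sub>R p" and "0 < \<nu>" "0 < r"
  shows "\<nu> * r * (norm (v - w))\<^sup>2 = 1 / (\<nu> * r) * (norm (kB *\<^sub>R g + (z * r) *\<^sub>R p))\<^sup>2"
proof -
  have "kB *\<^sub>R g + (z * r) *\<^sub>R p = - ((\<nu> * r) *\<^sub>R (v - w))"
    using assms(1) by simp
  then have "norm (kB *\<^sub>R g + (z * r) *\<^sub>R p) = \<nu> * r * norm (v - w)"
    using assms(2,3) by (simp del: scaleR_minus_left)
  then show ?thesis using assms(2,3) by (simp add: field_simps power2_eq_square)
qed

context
  fixes \<nu> kB z :: real and r T \<phi> :: scalar_field and v w :: vector_field
  assumes law: "\<And>y. (\<nu> * r y) *\<^sub>R (v y - w y) =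
      - (kB *\<^sub>R grad (\<lambda>y. r y * T y) y) - (z * r y) *\<^sub>R grad \<phi> y"
    and \<nu>: "\<nu> \<noteq> 0"
    and smooth: "twice_differentiable r" "twice_differentiable T" "twice_differentiable \<phi>"
    and w: "\<And>y. w differentiable (at y)"
begin

lemma divergence_flux:
  assumes "divergence w x = 0"
  shows "divergence (\<lambda>y. r y *\<^sub>R v y) x =
    w x \<bullet> grad r x - kB / \<nu> * laplacian (\<lambda>y. r y * T y) x
      - divergence (\<lambda>y. (z / \<nu> * r y) *\<^sub>R grad \<phi> y) x"
proof -
  have rT: "twice_differentiable (\<lambda>y. r y * T y)"
    by (intro twice_differentiable_mult smooth)
  have carried: "divergence (\<lambda>y. r y *\<^sub>R w y) x = w x \<bullet> grad r x"
    unfolding divergence_scaleR[OF twice_differentiableD(1)[OF smooth(1)] w]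
    by (simp add: assms inner_commute)
  have diffused: "divergence (\<lambda>y. (- kB / \<nu>) *\<^sub>R grad (\<lambda>y. r y * T y) y) x =
      - kB / \<nu> * laplacian (\<lambda>y. r y * T y) x"
    unfolding laplacian_eq_divergence_grad
    by (rule divergence_cscaleR[OF twice_differentiableD(2)[OF rT]])
  have drifted: "divergence (\<lambda>y. (- z / \<nu> * r y) *\<^sub>R grad \<phi> y) x =
      - divergence (\<lambda>y. (z / \<nu> * r y) *\<^sub>R grad \<phi> y) x"
    unfolding divergence_cmult_scaleR_grad[OF smooth(1,3)] by simp
  \<comment> \<open>The friction law holds at every point, so the flux may be replaced under the
    differential operator.\<close>
  have "divergence (\<lambda>y. r y *\<^sub>R v y) x = divergence (\<lambda>y. r y *\<^sub>R w y +
      ((- kB / \<nu>) *\<^sub>R grad (\<lambda>y. r y * T y) y + (- z / \<nu> * r y) *\<^sub>R grad \<phi> y)) x"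
    by (simp only: friction_law_flux[OF law \<nu>])
  \<comment> \<open>Additivity requires each part of the flux to be differentiable on its own; for
    the pressure and the drift part this is where the second derivatives of the density, the
    temperature and the potential are used.\<close>
  also have "\<dots> = divergence (\<lambda>y. r y *\<^sub>R w y) x +
      (divergence (\<lambda>y. (- kB / \<nu>) *\<^sub>R grad (\<lambda>y. r y * T y) y) x +
       divergence (\<lambda>y. (- z / \<nu> * r y) *\<^sub>R grad \<phi> y) x)"
    by (intro divergence_add[THEN trans] arg_cong2[of _ _ _ _ "(+)"] refl
        differentiable_add differentiable_scaleR differentiable_const
        differentiable_mult twice_differentiableD smooth rT w)
  finally show ?thesis
    unfolding carried diffused drifted by simp
qed

text \<open>Two terms occur both in the divergence of the flux and in
  \<open>v x \<bullet> grad r x\<close>, and cancel: the transport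
  \<open>w x \<bullet> grad r x\<close> and the drift term with
  \<open>grad r x \<bullet> grad \<phi> x\<close>. What survives are the two Laplacians and the
  gradient term divided by the density.\<close>

lemma density_mult_divergence:
  assumes "divergence w x = 0" "v differentiable (at x)" "r x \<noteq> 0"
  shows "r x * divergence v x =
    - (kB / \<nu> * laplacian (\<lambda>y. r y * T y) x)
      + kB / (\<nu> * r x) * (grad r x \<bullet> grad (\<lambda>y. r y * T y) x)
      - z / \<nu> * r x * laplacian \<phi> x"
proof -
  \<comment> \<open>The friction law controls only \<open>r x\<close> times the velocity; the
    identity is therefore written with the factor \<open>r x\<close> on both sides and then divided
    by it.\<close>
  have "r x * (v x \<bullet> grad r x) = r x * (w x \<bullet> grad r x
      - kB / (\<nu> * r x) * (grad (\<lambda>y. r y * T y) x \<bullet> grad r x) - z / \<nu> * (grad \<phi> x \<bullet> grad r x))"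
    using friction_law_flux_inner[OF law \<nu>, of x "grad r x"] assms(3)
    by (simp add: right_diff_distrib)
  then have "v x \<bullet> grad r x = w x \<bullet> grad r x
      - kB / (\<nu> * r x) * (grad (\<lambda>y. r y * T y) x \<bullet> grad r x) - z / \<nu> * (grad \<phi> x \<bullet> grad r x)"
    using assms(3) by simp
  moreover have "z / \<nu> * (r x * laplacian \<phi> x + grad r x \<bullet> grad \<phi> x) =
      z / \<nu> * r x * laplacian \<phi> x + z / \<nu> * (grad \<phi> x \<bullet> grad r x)"
    by (simp add: distrib_left inner_commute)
  ultimately show ?thesis
    using divergence_flux[OF assms(1)]
    unfolding divergence_cmult_scaleR_grad[OF smooth(1,3)]
      divergence_scaleR[OF twice_differentiableD(1)[OF smooth(1)] assms(2)]
    by (simp only: inner_commute)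
qed

end

section \<open>Momentum, heat and charge: sums over the species\<close>

context
  fixes N :: nat and kB :: real and \<nu> z :: "nat \<Rightarrow> real"
    and r :: "nat \<Rightarrow> scalar_field" and T \<phi> :: scalar_field and u :: "nat \<Rightarrow> vector_field"
  assumes law: "\<And>i y. i \<in> {1..N} \<Longrightarrow> (\<nu> i * r i y) *\<^sub>R (u i y - u 0 y) =
      - (kB *\<^sub>R grad (\<lambda>y. r i y * T y) y) - (z i * r i y) *\<^sub>R grad \<phi> y"
    and \<nu>: "\<And>i. i \<in> {1..N} \<Longrightarrow> 0 < \<nu> i"
    and r: "\<And>i y. i \<in> {1..N} \<Longrightarrow> 0 < r i y"
begin

text \<open>The drag on the solvent is the negative of the friction law. All drift parts share the
  factor \<open>grad \<phi> x\<close>, so their coefficients add up to the total charge.\<close>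

lemma momentum_source:
  "(\<Sum>i=1..N. (\<nu> i * r i x) *\<^sub>R (u 0 x - u i x)) =
    (\<Sum>i=1..N. kB *\<^sub>R grad (\<lambda>y. r i y * T y) x) + (\<Sum>i=1..N. z i * r i x) *\<^sub>R grad \<phi> x"
proof -
  have "(\<nu> i * r i x) *\<^sub>R (u 0 x - u i x) =
      kB *\<^sub>R grad (\<lambda>y. r i y * T y) x + (z i * r i x) *\<^sub>R grad \<phi> x" if "i \<in> {1..N}" for i
    using arg_cong[OF law[OF that, of x], of uminus]
    by (simp flip: scaleR_minus_right)
  then show ?thesis
    by (simp add: sum.distrib scaleR_sum_left)
qed

lemma heat_convection:
  "(\<Sum>i=0..N. (kB * c i * r i x) *\<^sub>R u i x) \<bullet> h =
    (\<Sum>i=0..N. kB * c i * r i x * (u 0 x \<bullet> h))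
      - (\<Sum>i=1..N. kB\<^sup>2 * c i / \<nu> i * (grad (\<lambda>y. r i y * T y) x \<bullet> h))
      - (\<Sum>i=1..N. kB * c i * z i / \<nu> i * r i x * (grad \<phi> x \<bullet> h))"
proof -
  have "kB * c i * r i x * (u i x \<bullet> h) = kB * c i * r i x * (u 0 x \<bullet> h)
      - kB\<^sup>2 * c i / \<nu> i * (grad (\<lambda>y. r i y * T y) x \<bullet> h)
      - kB * c i * z i / \<nu> i * r i x * (grad \<phi> x \<bullet> h)" if "i \<in> {1..N}" for i
    using arg_cong[OF friction_law_flux_inner[OF law[OF that], of x h],
        of "\<lambda>a. kB * c i * a"] \<nu>[OF that]
    by (simp add: algebra_simps power2_eq_square)
  then have "(\<Sum>i=1..N. kB * c i * r i x * (u i x \<bullet> h)) =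
      (\<Sum>i=1..N. kB * c i * r i x * (u 0 x \<bullet> h))
      - (\<Sum>i=1..N. kB\<^sup>2 * c i / \<nu> i * (grad (\<lambda>y. r i y * T y) x \<bullet> h))
      - (\<Sum>i=1..N. kB * c i * z i / \<nu> i * r i x * (grad \<phi> x \<bullet> h))"
    by (simp add: sum_subtractf)
  \<comment> \<open>Index 0 is split off: its velocity is already \<open>u 0\<close>, and only the
    remaining summands go through the friction law.\<close>
  then show ?thesis
    by (simp add: inner_sum_left inner_add_left sum.atLeast_Suc_atMost)
qed

lemma friction_heating:
  "(\<Sum>i=1..N. \<nu> i * r i x * (norm (u i x - u 0 x))\<^sup>2) =
    (\<Sum>i=1..N. 1 / (\<nu> i * r i x) *
      (norm (kB *\<^sub>R grad (\<lambda>y. r i y * T y) x + (z i * r i x) *\<^sub>R grad \<phi> x))\<^sup>2)"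
  by (intro sum.cong refl friction_law_heating law \<nu> r)

text \<open>Written as minus a sum because the term changes sides in the heat equation, where the
  sum becomes the bracket multiplying the temperature. The Poisson equation enters as a value at the
  point \<open>x\<close>, which is the form in which it is available when the two heat equations are
  compared.\<close>

lemma compression_work:
  assumes smooth: "\<And>i. i \<in> {1..N} \<Longrightarrow> twice_differentiable (r i)"
      "twice_differentiable T" "twice_differentiable \<phi>"
    and u: "\<And>i y. i \<le> N \<Longrightarrow> u i differentiable (at y)"
    and "divergence (u 0) x = 0" and poisson: "laplacian \<phi> x = - (m / \<epsilon>)"
  shows "(\<Sum>i=1..N. kB * r i x * divergence (u i) x) =
    - (\<Sum>i=1..N. kB\<^sup>2 / \<nu> i * laplacian (\<lambda>y. r i y * T y) x
         - kB\<^sup>2 / (\<nu> i * r i x) * (grad (r i) x \<bullet> grad (\<lambda>y. r i y * T y) x)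
         - kB * z i / (\<epsilon> * \<nu> i) * r i x * m)"
  unfolding sum_negf[symmetric]
proof (rule sum.cong[OF refl])
  fix i assume i: "i \<in> {1..N}"
  have "r i x * divergence (u i) x =
      - (kB / \<nu> i * laplacian (\<lambda>y. r i y * T y) x)
      + kB / (\<nu> i * r i x) * (grad (r i) x \<bullet> grad (\<lambda>y. r i y * T y) x)
      - z i / \<nu> i * r i x * laplacian \<phi> x"
  proof (rule density_mult_divergence[OF law[OF i] _ smooth(1)[OF i] smooth(2,3) u assms(5)])
    show "\<nu> i \<noteq> 0" "r i x \<noteq> 0" using \<nu>[OF i] r[OF i, of x] by simp_all
    show "u i differentiable (at x)" using i by (intro u) simp
  qed simp
  from arg_cong[OF this, of "\<lambda>a. kB * a"]
  show "kB * r i x * divergence (u i) x =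
      - (kB\<^sup>2 / \<nu> i * laplacian (\<lambda>y. r i y * T y) x
         - kB\<^sup>2 / (\<nu> i * r i x) * (grad (r i) x \<bullet> grad (\<lambda>y. r i y * T y) x)
         - kB * z i / (\<epsilon> * \<nu> i) * r i x * m)"
    by (simp add: poisson power2_eq_square algebra_simps)
qed

end

text \<open>The number \<open>dr i\<close> stands for the time derivative of the i-th density at the
  point, and \<open>b\<close> for the mean friction. The terms with \<open>1 / b\<close> on the two
  sides agree because the Laplacian of \<open>m T\<close> is the weighted sum of the Laplacians of
  the pressures \<open>r i T\<close>.\<close>

lemma charge_equation:
  fixes r :: "nat \<Rightarrow> scalar_field"
  assumes eq: "\<And>i. i \<in> {1..N} \<Longrightarrow>
      dr i + w \<bullet> grad (r i) x - kB / \<nu> i * laplacian (\<lambda>y. r i y * T y) x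
        - divergence (\<lambda>y. (z i / \<nu> i * r i y) *\<^sub>R grad \<phi> y) x = 0"
    and smooth: "\<And>i. i \<in> {1..N} \<Longrightarrow> twice_differentiable (r i)"
      "twice_differentiable T" "twice_differentiable \<phi>"
    and m: "m = (\<lambda>y. \<Sum>i=1..N. z i * r i y)"
  shows "(\<Sum>i=1..N. z i * dr i) + w \<bullet> grad m x - kB / b * laplacian (\<lambda>y. m y * T y) x =
    (\<Sum>i=1..N. (z i)\<^sup>2 / \<nu> i * divergence (\<lambda>y. r i y *\<^sub>R grad \<phi> y) x)
      + kB * (\<Sum>i=1..N. (1 / \<nu> i - 1 / b) * z i * laplacian (\<lambda>y. r i y * T y) x)"
proof -
  have rT: "twice_differentiable (\<lambda>y. r i y * T y)" if "i \<in> {1..N}" for i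
    by (intro twice_differentiable_mult smooth that)
  have "grad m x = (\<Sum>i=1..N. grad (\<lambda>y. z i * r i y) x)"
    unfolding m
    by (intro grad_sum differentiable_mult differentiable_const twice_differentiableD smooth)
  also have "\<dots> = (\<Sum>i=1..N. z i *\<^sub>R grad (r i) x)"
    by (intro sum.cong refl grad_cmult twice_differentiableD smooth)
  finally have grad_m: "w \<bullet> grad m x = (\<Sum>i=1..N. z i * (w \<bullet> grad (r i) x))"
    by (simp add: inner_sum_right)
  have "laplacian (\<lambda>y. m y * T y) x = laplacian (\<lambda>y. \<Sum>i=1..N. z i * (r i y * T y)) x"
    by (simp add: m sum_distrib_right mult.assoc)
  also have "\<dots> = (\<Sum>i=1..N. laplacian (\<lambda>y. z i * (r i y * T y)) x)"
    by (intro laplacian_sum twice_differentiable_mult twice_differentiable_const smooth)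
  also have "\<dots> = (\<Sum>i=1..N. z i * laplacian (\<lambda>y. r i y * T y) x)"
    by (intro sum.cong refl laplacian_cmult rT)
  finally have lap_mT: "laplacian (\<lambda>y. m y * T y) x = \<dots>" .
  have summand: "z i * dr i + z i * (w \<bullet> grad (r i) x)
        - kB / b * (z i * laplacian (\<lambda>y. r i y * T y) x) =
      (z i)\<^sup>2 / \<nu> i * divergence (\<lambda>y. r i y *\<^sub>R grad \<phi> y) x
        + kB * ((1 / \<nu> i - 1 / b) * z i * laplacian (\<lambda>y. r i y * T y) x)"
    if i: "i \<in> {1..N}" for i
  proof -
    \<comment> \<open>Pulling the mobility out of the divergence gives one factor
      \<open>z i\<close>; the weight of the density equation gives the second one in
      \<open>(z i)\<^sup>2\<close>.\<close>
    have "divergence (\<lambda>y. (z i / \<nu> i * r i y) *\<^sub>R grad \<phi> y) x =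
        z i / \<nu> i * divergence (\<lambda>y. r i y *\<^sub>R grad \<phi> y) x"
      unfolding divergence_cmult_scaleR_grad[OF smooth(1)[OF i] smooth(3)]
        divergence_scaleR_grad[OF smooth(1)[OF i] smooth(3)] ..
    with eq[OF i] have dr: "dr i = - (w \<bullet> grad (r i) x)
        + kB / \<nu> i * laplacian (\<lambda>y. r i y * T y) x
        + z i / \<nu> i * divergence (\<lambda>y. r i y *\<^sub>R grad \<phi> y) x"
      by linarith
    show ?thesis unfolding dr by (simp add: algebra_simps power2_eq_square)
  qed
  show ?thesis
    unfolding grad_m lap_mT sum_distrib_left sum.distrib[symmetric] sum_subtractf[symmetric]
    by (rule sum.cong[OF refl summand])
qed

section \<open>Derivatives of fields shifted by constants\<close>

lemma grad_shift:
  assumes "f differentiable (at x)"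
  shows "grad (\<lambda>y. d + f y) x = grad f x"
  using grad_add[OF differentiable_const assms, of d] by (simp add: grad_const)

lemma laplacian_shift:
  assumes "twice_differentiable f"
  shows "laplacian (\<lambda>y. d + f y) x = laplacian f x"
  using laplacian_add[OF twice_differentiable_const assms, of d] by (simp add: laplacian_const)

lemma twice_differentiable_perturbation_product:
  assumes "twice_differentiable f" "twice_differentiable g"
  shows "twice_differentiable (\<lambda>y. f y + d * g y + f y * g y)"
  by (intro twice_differentiable_add twice_differentiable_mult twice_differentiable_const assms)

lemma perturbation_product:
  "(\<lambda>y. (d + f y) * (1 + g y)) = (\<lambda>y. d + (f y + d * g y + f y * g y))" for d :: real
  by (auto simp: algebra_simps)

lemma grad_perturbation_product:
  assumes "twice_differentiable f" "twice_differentiable g"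
  shows "grad (\<lambda>y. (d + f y) * (1 + g y)) x = grad (\<lambda>y. f y + d * g y + f y * g y) x"
  unfolding perturbation_product
  by (intro grad_shift twice_differentiableD twice_differentiable_perturbation_product assms)

lemma laplacian_perturbation_product:
  assumes "twice_differentiable f" "twice_differentiable g"
  shows "laplacian (\<lambda>y. (d + f y) * (1 + g y)) x = laplacian (\<lambda>y. f y + d * g y + f y * g y) x"
  unfolding perturbation_product
  by (intro laplacian_shift twice_differentiable_perturbation_product assms)

text \<open>Separates the part linear in the perturbation, which belongs to the principal part of
  the density and heat equations, from the product \<open>f y * g y\<close>, which goes into the
  remainders.\<close>

lemma laplacian_perturbation_product_expand:
  assumes "twice_differentiable f" "twice_differentiable g"
  shows "laplacian (\<lambda>y. f y + d * g y + f y * g y) x =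
    laplacian f x + d * laplacian g x + laplacian (\<lambda>y. f y * g y) x"
proof -
  have dg: "twice_differentiable (\<lambda>y. d * g y)" and fg: "twice_differentiable (\<lambda>y. f y * g y)"
    by (intro twice_differentiable_mult twice_differentiable_const assms)+
  show ?thesis
    unfolding laplacian_add[OF twice_differentiable_add[OF assms(1) dg] fg]
      laplacian_add[OF assms(1) dg] laplacian_cmult[OF assms(2)] ..
qed

section \<open>The perturbed equations at a fixed time and point\<close>

context
  fixes N :: nat and \<epsilon> :: real and \<nu> z \<delta> :: "nat \<Rightarrow> real"
    and r n :: "nat \<Rightarrow> scalar_field" and T \<theta> m \<phi> :: scalar_field and x :: "real ^ 3"
  assumes r_eq: "\<And>i. i \<in> {1..N} \<Longrightarrow> r i = (\<lambda>y. \<delta> i + n i y)"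
    and T_eq: "T = (\<lambda>y. 1 + \<theta> y)"
    and smooth: "\<And>i. i \<in> {1..N} \<Longrightarrow> twice_differentiable (n i)"
      "twice_differentiable \<theta>" "twice_differentiable \<phi>"
    and poisson: "laplacian \<phi> x = - (m x / \<epsilon>)"
begin

lemma perturbed_grad_pressure:
  "i \<in> {1..N} \<Longrightarrow> grad (\<lambda>y. r i y * T y) x = grad (\<lambda>y. n i y + \<delta> i * \<theta> y + n i y * \<theta> y) x"
  unfolding r_eq T_eq by (intro grad_perturbation_product smooth)

lemma perturbed_laplacian_pressure:
  "i \<in> {1..N} \<Longrightarrow> laplacian (\<lambda>y. r i y * T y) x =
    laplacian (\<lambda>y. n i y + \<delta> i * \<theta> y + n i y * \<theta> y) x"
  unfolding r_eq T_eq by (intro laplacian_perturbation_product smooth)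

lemma perturbed_grad_density: "i \<in> {1..N} \<Longrightarrow> grad (r i) x = grad (n i) x"
  unfolding r_eq by (intro grad_shift twice_differentiableD smooth)

lemma perturbed_density_equation:
  assumes i: "i \<in> {1..N}"
    and eq: "dr + w x \<bullet> grad (r i) x - kB / \<nu> i * laplacian (\<lambda>y. r i y * T y) x
        - divergence (\<lambda>y. (z i / \<nu> i * r i y) *\<^sub>R grad \<phi> y) x = 0"
  shows "dr - kB / \<nu> i * laplacian (n i) x =
    kB * \<delta> i / \<nu> i * laplacian \<theta> x + z i * \<delta> i / \<nu> i * laplacian \<phi> x
      + R_n kB \<epsilon> \<nu> z i n \<theta> m \<phi> w x"
proof -
  have "twice_differentiable (r i)"
    unfolding r_eq[OF i] by (intro twice_differentiable_add twice_differentiable_const smooth i)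
  from divergence_cmult_scaleR_grad[OF this smooth(3)]
  have "divergence (\<lambda>y. (z i / \<nu> i * r i y) *\<^sub>R grad \<phi> y) x =
      z i / \<nu> i * ((\<delta> i + n i x) * laplacian \<phi> x + grad (n i) x \<bullet> grad \<phi> x)"
    \<comment> \<open>The gradient is rewritten while it still has the form
      \<open>grad (r i) x\<close>; only then is the density itself unfolded.\<close>
    by (simp only: perturbed_grad_density[OF i]) (simp only: r_eq[OF i])
  with eq have dr: "dr = - (w x \<bullet> grad (n i) x)
      + kB / \<nu> i * (laplacian (n i) x + \<delta> i * laplacian \<theta> x + laplacian (\<lambda>y. n i y * \<theta> y) x)
      + z i / \<nu> i * ((\<delta> i + n i x) * laplacian \<phi> x + grad (n i) x \<bullet> grad \<phi> x)"
    unfolding perturbed_grad_density[OF i] perturbed_laplacian_pressure[OF i]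
      laplacian_perturbation_product_expand[OF smooth(1)[OF i] smooth(2)]
    by linarith
  \<comment> \<open>With the Poisson equation inserted everywhere, the \<delta>-part of the drift
    matches the linear term and the \<open>n i\<close>-part matches the product of
    \<open>n i\<close> and \<open>m\<close> in \<open>R_n\<close>.\<close>
  show ?thesis
    unfolding dr R_n_def poisson by (simp add: algebra_simps)
qed

lemma perturbed_momentum_source:
  "(\<Sum>i=1..N. kB *\<^sub>R grad (\<lambda>y. r i y * T y) x) + m x *\<^sub>R grad \<phi> x =
    (\<Sum>i=1..N. kB *\<^sub>R grad (\<lambda>y. n i y + \<delta> i * \<theta> y) x) + R_u N kB n \<theta> m \<phi> x"
proof -
  have "grad (\<lambda>y. n i y + \<delta> i * \<theta> y + n i y * \<theta> y) x =
      grad (\<lambda>y. n i y + \<delta> i * \<theta> y) x + grad (\<lambda>y. n i y * \<theta> y) x" if "i \<in> {1..N}" for i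
    by (intro grad_add twice_differentiableD twice_differentiable_add twice_differentiable_mult
        twice_differentiable_const smooth that)
  then have "(\<Sum>i=1..N. kB *\<^sub>R grad (\<lambda>y. r i y * T y) x) =
      (\<Sum>i=1..N. kB *\<^sub>R grad (\<lambda>y. n i y + \<delta> i * \<theta> y) x + kB *\<^sub>R grad (\<lambda>y. n i y * \<theta> y) x)"
    by (intro sum.cong refl) (simp only: perturbed_grad_pressure scaleR_add_right)
  then show ?thesis by (simp add: R_u_def sum.distrib)
qed

text \<open>Derived from the perturbed density equations with weights \<open>z i\<close>, not from
  the charge equation of the reduced system. The linear drift, with
  \<open>laplacian \<phi> x\<close> replaced by the charge, becomes the damping term on the left,
  and the weighted remainders \<open>R_n\<close> add up to \<open>R_m\<close>.\<close>

lemma perturbed_charge_equation: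
  assumes eq: "\<And>i. i \<in> {1..N} \<Longrightarrow> dn i - kB / \<nu> i * laplacian (n i) x =
      kB * \<delta> i / \<nu> i * laplacian \<theta> x + z i * \<delta> i / \<nu> i * laplacian \<phi> x
        + R_n kB \<epsilon> \<nu> z i n \<theta> m \<phi> w x"
    and m: "m = (\<lambda>y. \<Sum>i=1..N. z i * n i y)"
  shows "(\<Sum>i=1..N. z i * dn i) - kB / b * laplacian m x
      + 1 / \<epsilon> * (\<Sum>i=1..N. (z i)\<^sup>2 * \<delta> i / \<nu> i) * m x =
    kB * (\<Sum>i=1..N. (1 / \<nu> i - 1 / b) * z i * laplacian (n i) x)
      + kB * (\<Sum>i=1..N. z i * \<delta> i / \<nu> i * laplacian \<theta> x)
      + R_m N kB \<epsilon> \<nu> z n \<theta> m \<phi> w x"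
proof -
  have "grad m x = (\<Sum>i=1..N. grad (\<lambda>y. z i * n i y) x)"
    unfolding m
    by (intro grad_sum differentiable_mult differentiable_const twice_differentiableD smooth)
  also have "\<dots> = (\<Sum>i=1..N. z i *\<^sub>R grad (n i) x)"
    by (intro sum.cong refl grad_cmult twice_differentiableD smooth)
  finally have grad_m: "w x \<bullet> grad m x = (\<Sum>i=1..N. z i * (w x \<bullet> grad (n i) x))"
    by (simp add: inner_sum_right)
  have "laplacian m x = (\<Sum>i=1..N. laplacian (\<lambda>y. z i * n i y) x)"
    unfolding m
    by (intro laplacian_sum twice_differentiable_mult twice_differentiable_const smooth)
  also have "\<dots> = (\<Sum>i=1..N. z i * laplacian (n i) x)"
    by (intro sum.cong refl laplacian_cmult smooth)
  finally have lap_m: "laplacian m x = \<dots>" .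
  have summand: "z i * dn i - kB / b * (z i * laplacian (n i) x)
        + 1 / \<epsilon> * ((z i)\<^sup>2 * \<delta> i / \<nu> i) * m x =
      kB * ((1 / \<nu> i - 1 / b) * z i * laplacian (n i) x)
        + kB * (z i * \<delta> i / \<nu> i * laplacian \<theta> x)
        + (- (z i * (w x \<bullet> grad (n i) x))
           + kB * (z i / \<nu> i * laplacian (\<lambda>y. n i y * \<theta> y) x)
           - 1 / \<epsilon> * ((z i)\<^sup>2 / \<nu> i * n i x * m x)
           + (z i)\<^sup>2 / \<nu> i * (grad (n i) x \<bullet> grad \<phi> x))" if i: "i \<in> {1..N}" for i
  proof -
    have dn: "dn i = kB / \<nu> i * laplacian (n i) x + kB * \<delta> i / \<nu> i * laplacian \<theta> x
        + z i * \<delta> i / \<nu> i * laplacian \<phi> x + R_n kB \<epsilon> \<nu> z i n \<theta> m \<phi> w x"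
      using eq[OF i] by linarith
    show ?thesis
      unfolding dn R_n_def poisson by (simp add: algebra_simps power2_eq_square)
  qed
  show ?thesis
    unfolding R_m_def grad_m lap_m sum_distrib_left sum_distrib_right
      sum.distrib[symmetric] sum_subtractf[symmetric] sum_negf[symmetric]
    by (rule sum.cong[OF refl summand])
qed

text \<open>Here \<open>A\<close> is the full heat capacity and \<open>coeff_a\<close> its constant
  part. Dividing by \<open>A\<close> and multiplying by \<open>coeff_a\<close> gives the time
  derivative a constant coefficient; the price is the quotients in \<open>R_theta\<close>.\<close>

lemma perturbed_heat_equation:
  assumes eq: "A * dT - k * laplacian T x + A * (w x \<bullet> grad T x)
      - (\<Sum>i=1..N. kB\<^sup>2 * c i / \<nu> i * (grad (\<lambda>y. r i y * T y) x \<bullet> grad T x))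
      = lam * grad_norm_sq w x
        + (\<Sum>i=1..N. 1 / (\<nu> i * r i x) *
            (norm (kB *\<^sub>R grad (\<lambda>y. r i y * T y) x + (z i * r i x) *\<^sub>R grad \<phi> x))\<^sup>2)
        + (\<Sum>i=1..N. kB * c i * z i / \<nu> i * r i x * (grad \<phi> x \<bullet> grad T x))
        + (\<Sum>i=1..N. kB\<^sup>2 / \<nu> i * laplacian (\<lambda>y. r i y * T y) x
            - kB\<^sup>2 / (\<nu> i * r i x) * (grad (r i) x \<bullet> grad (\<lambda>y. r i y * T y) x)
            - kB * z i / (\<epsilon> * \<nu> i) * r i x * m x) * T x"
    and A: "A = coeff_a N kB \<rho>0 c \<delta> + (\<Sum>i=1..N. kB * c i * n i x)" "A \<noteq> 0"
  shows "coeff_a N kB \<rho>0 c \<delta> * dT - coeff_b N kB k \<nu> \<delta> * laplacian \<theta> x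
      = (\<Sum>i=1..N. kB\<^sup>2 / \<nu> i * laplacian (n i) x)
        + (\<Sum>i=1..N. kB * z i * \<delta> i / \<nu> i * laplacian \<phi> x)
        + R_theta N kB k \<epsilon> lam \<rho>0 c \<nu> z \<delta> n \<theta> m \<phi> w x"
proof -
  define q where "q i y = n i y + \<delta> i * \<theta> y + n i y * \<theta> y" for i y
  have grad_T: "grad T x = grad \<theta> x" and lap_T: "laplacian T x = laplacian \<theta> x"
    unfolding T_eq by (intro grad_shift laplacian_shift twice_differentiableD smooth)+
  have grad_rT: "grad (\<lambda>y. r i y * T y) x = grad (q i) x" if "i \<in> {1..N}" for i
    using perturbed_grad_pressure[OF that] unfolding q_def .
  have lap_rT: "laplacian (\<lambda>y. r i y * T y) x = laplacian (q i) x" if "i \<in> {1..N}" for i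
    using perturbed_laplacian_pressure[OF that] unfolding q_def .
  have r_x: "r i x = \<delta> i + n i x" if "i \<in> {1..N}" for i
    by (simp only: r_eq[OF that])
  have T_x: "T x = 1 + \<theta> x" by (simp only: T_eq)
  note rewrite = grad_rT lap_rT r_x perturbed_grad_density grad_T T_x
  \<comment> \<open>The sums are named so that the assembly is linear arithmetic. \<open>S1\<close>
    and \<open>S3\<close> are convection by pressure gradient and drift, \<open>S2\<close> is
    frictional heating, \<open>S4\<close> is compression work, and \<open>S5\<close> is the share of
    \<open>S4\<close> that remains in \<open>R_theta_star\<close> once the linear terms are
    removed.\<close>
  define S1 where "S1 = (\<Sum>i=1..N. kB\<^sup>2 * c i / \<nu> i * (grad (q i) x \<bullet> grad \<theta> x))"
  define S2 where "S2 = (\<Sum>i=1..N. 1 / (\<nu> i * (\<delta> i + n i x)) *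
         (norm (kB *\<^sub>R grad (q i) x + (z i * (\<delta> i + n i x)) *\<^sub>R grad \<phi> x))\<^sup>2)"
  define S3 where
    "S3 = (\<Sum>i=1..N. kB * c i * z i / \<nu> i * (\<delta> i + n i x) * (grad \<phi> x \<bullet> grad \<theta> x))"
  define S4 where "S4 = (\<Sum>i=1..N. (kB\<^sup>2 / \<nu> i * laplacian (q i) x
            - kB\<^sup>2 / (\<nu> i * (\<delta> i + n i x)) * (grad (n i) x \<bullet> grad (q i) x)
            - kB * z i / (\<epsilon> * \<nu> i) * (\<delta> i + n i x) * m x) * (1 + \<theta> x))"
  define S5 where "S5 = (\<Sum>i=1..N. kB\<^sup>2 / \<nu> i * laplacian (\<lambda>y. n i y * \<theta> y) x)
     - (\<Sum>i=1..N. kB * z i / (\<epsilon> * \<nu> i) * n i x * m x)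
     - (\<Sum>i=1..N. kB\<^sup>2 / (\<nu> i * (\<delta> i + n i x)) * (1 + \<theta> x) * (grad (n i) x \<bullet> grad (q i) x))
     + (\<Sum>i=1..N. kB\<^sup>2 / \<nu> i * laplacian (q i) x * \<theta> x)
     - (\<Sum>i=1..N. kB * z i / (\<epsilon> * \<nu> i) * (\<delta> i + n i x) * m x * \<theta> x)"
  define L where "L = coeff_b N kB k \<nu> \<delta> * laplacian \<theta> x
      + (\<Sum>i=1..N. kB\<^sup>2 / \<nu> i * laplacian (n i) x)
      - (\<Sum>i=1..N. kB * z i * \<delta> i / (\<epsilon> * \<nu> i) * m x)"
  define R where "R = R_theta_star N kB \<epsilon> lam c \<nu> z \<delta> n \<theta> m \<phi> w x"
  \<comment> \<open>The rewrite rules for the densities hold for indices in \<open>{1..N}\<close>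
    only; \<open>sum.cong\<close> supplies this membership under the sums.\<close>
  have "A * dT - k * laplacian \<theta> x + A * (w x \<bullet> grad \<theta> x) - S1 =
      lam * grad_norm_sq w x + S2 + S3 + S4"
    using eq unfolding S1_def S2_def S3_def S4_def sum_distrib_right lap_T
    by (simp only: rewrite cong: sum.cong)
  moreover have "k * laplacian \<theta> x + S4 = L + S5"
  proof -
    have summand: "(kB\<^sup>2 / \<nu> i * laplacian (q i) x
            - kB\<^sup>2 / (\<nu> i * (\<delta> i + n i x)) * (grad (n i) x \<bullet> grad (q i) x)
            - kB * z i / (\<epsilon> * \<nu> i) * (\<delta> i + n i x) * m x) * (1 + \<theta> x) =
        kB\<^sup>2 * \<delta> i / \<nu> i * laplacian \<theta> x + kB\<^sup>2 / \<nu> i * laplacian (n i) x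
          - kB * z i * \<delta> i / (\<epsilon> * \<nu> i) * m x
          + (kB\<^sup>2 / \<nu> i * laplacian (\<lambda>y. n i y * \<theta> y) x
             - kB * z i / (\<epsilon> * \<nu> i) * n i x * m x
             - kB\<^sup>2 / (\<nu> i * (\<delta> i + n i x)) * (1 + \<theta> x) * (grad (n i) x \<bullet> grad (q i) x)
             + kB\<^sup>2 / \<nu> i * laplacian (q i) x * \<theta> x
             - kB * z i / (\<epsilon> * \<nu> i) * (\<delta> i + n i x) * m x * \<theta> x)" if i: "i \<in> {1..N}" for i
    proof -
      \<comment> \<open>\<open>G\<close> hides the quotient with the variable denominator: the
        gradient term passes to the other side unchanged, multiplied by
        \<open>1 + \<theta> x\<close>.\<close>
      define G where "G = kB\<^sup>2 / (\<nu> i * (\<delta> i + n i x)) * (grad (n i) x \<bullet> grad (q i) x)"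
      have "laplacian (q i) x =
          laplacian (n i) x + \<delta> i * laplacian \<theta> x + laplacian (\<lambda>y. n i y * \<theta> y) x"
        unfolding q_def by (intro laplacian_perturbation_product_expand smooth i)
      then have "kB\<^sup>2 / \<nu> i * laplacian (q i) x = kB\<^sup>2 / \<nu> i * laplacian (n i) x
          + kB\<^sup>2 * \<delta> i / \<nu> i * laplacian \<theta> x + kB\<^sup>2 / \<nu> i * laplacian (\<lambda>y. n i y * \<theta> y) x"
        by (simp add: distrib_left)
      moreover have "kB\<^sup>2 / (\<nu> i * (\<delta> i + n i x)) * (1 + \<theta> x) * (grad (n i) x \<bullet> grad (q i) x) =
          G * (1 + \<theta> x)"
        unfolding G_def by simp
      moreover have "kB * z i / (\<epsilon> * \<nu> i) * (\<delta> i + n i x) * m x =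
          kB * z i * \<delta> i / (\<epsilon> * \<nu> i) * m x + kB * z i / (\<epsilon> * \<nu> i) * n i x * m x"
        by (simp add: distrib_left distrib_right add_divide_distrib)
      ultimately show ?thesis
        unfolding G_def[symmetric] by (simp add: distrib_left left_diff_distrib)
    qed
    have "S4 = (\<Sum>i=1..N. kB\<^sup>2 * \<delta> i / \<nu> i * laplacian \<theta> x)
        + (\<Sum>i=1..N. kB\<^sup>2 / \<nu> i * laplacian (n i) x)
        - (\<Sum>i=1..N. kB * z i * \<delta> i / (\<epsilon> * \<nu> i) * m x) + S5"
      unfolding S4_def S5_def sum.distrib[symmetric] sum_subtractf[symmetric]
      by (rule sum.cong[OF refl summand])
    moreover have "coeff_b N kB k \<nu> \<delta> * laplacian \<theta> x =
        k * laplacian \<theta> x + (\<Sum>i=1..N. kB\<^sup>2 * \<delta> i / \<nu> i * laplacian \<theta> x)"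
      by (simp add: coeff_b_def distrib_right sum_distrib_right)
    ultimately show ?thesis unfolding L_def by linarith
  qed
  moreover have "R = S1 + S3 + S5 + lam * grad_norm_sq w x + S2"
    unfolding R_def R_theta_star_def Let_def S1_def S2_def S3_def S5_def q_def by simp
  ultimately have balance: "A * (dT + w x \<bullet> grad \<theta> x) = L + R"
    by (simp add: distrib_left)
  define s where "s = (\<Sum>i=1..N. kB * c i * n i x)"
  define a where "a = coeff_a N kB \<rho>0 c \<delta>"
  have "a + s \<noteq> 0" using A unfolding a_def s_def by simp
  have "dT + w x \<bullet> grad \<theta> x = (L + R) / (a + s)"
    using balance A unfolding a_def[symmetric] s_def[symmetric] by (simp add: field_simps)
  then have dT: "dT = (L + R) / (a + s) - w x \<bullet> grad \<theta> x" by simp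
  have "a / (a + s) = 1 - s / (a + s)"
    using \<open>a + s \<noteq> 0\<close> by (simp add: field_simps)
  then have "a / (a + s) * L = L - s / (a + s) * L"
    by (simp only: left_diff_distrib mult_1)
  moreover have "a * dT = a / (a + s) * L + a * R / (a + s) - a * (w x \<bullet> grad \<theta> x)"
    unfolding dT by (simp add: right_diff_distrib distrib_left add_divide_distrib)
  ultimately have "a * dT = L - a * (w x \<bullet> grad \<theta> x) + a * R / (a + s) - s / (a + s) * L"
    by linarith
  \<comment> \<open>\<open>L\<close> was written with the charge, as in \<open>R_theta\<close>,
    whereas the linear term of the claim contains the Laplacian of the potential.\<close>
  moreover have "(\<Sum>i=1..N. kB * z i * \<delta> i / \<nu> i * laplacian \<phi> x) =
      - (\<Sum>i=1..N. kB * z i * \<delta> i / (\<epsilon> * \<nu> i) * m x)"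
    unfolding sum_negf[symmetric]
    by (intro sum.cong refl) (simp add: poisson)
  ultimately show ?thesis
    unfolding R_theta_def Let_def a_def[symmetric] s_def[symmetric] R_def[symmetric]
      L_def by linarith
qed

end

section \<open>Equivalence with the reduced system and passage to the perturbations\<close>

theorem lemmaA1:
  fixes N l :: nat
    and kB k \<epsilon> lam \<rho>0 :: real
    and c \<nu> z :: "nat \<Rightarrow> real"
    and \<rho> :: "nat \<Rightarrow> real \<Rightarrow> real ^ 3 \<Rightarrow> real"
    and T \<phi> P m :: "real \<Rightarrow> real ^ 3 \<Rightarrow> real"
    and u :: "nat \<Rightarrow> real \<Rightarrow> real ^ 3 \<Rightarrow> real ^ 3"
  assumes "2 \<le> N"
    and "admissible_coefficients N l kB k \<epsilon> lam \<rho>0 c \<nu> z"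
    and "sufficiently_smooth N \<rho> T \<phi> P u"
    and "\<forall>t>0. \<forall>x. \<rho> 0 t x = \<rho>0"
    and "\<forall>i\<in>{1..N}. \<forall>t>0. \<forall>x. 0 < \<rho> i t x"
    and "\<forall>t>0. \<forall>x. m t x = (\<Sum>j=1..N. z j * \<rho> j t x)"
  shows "(pnpf_system N kB k \<epsilon> lam c \<nu> z \<rho> T \<phi> P u \<longleftrightarrow>
            friction_law N kB \<nu> z \<rho> T \<phi> u \<and> far_field \<phi> (u 0) \<and>
            reduced_system N kB k \<epsilon> lam c \<nu> z \<rho> T m \<phi> P (u 0)) \<and>
         (pnpf_system N kB k \<epsilon> lam c \<nu> z \<rho> T \<phi> P u \<longrightarrow>
            (\<forall>(\<delta> :: nat \<Rightarrow> real) (n :: nat \<Rightarrow> real \<Rightarrow> real ^ 3 \<Rightarrow> real) (\<theta> :: real \<Rightarrow> real ^ 3 \<Rightarrow> real).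
               (\<forall>i\<in>{1..N}. 0 < \<delta> i) \<and> (\<Sum>j=1..N. z j * \<delta> j) = 0 \<and>
               (\<forall>i\<in>{1..N}. \<forall>t>0. \<forall>x. \<rho> i t x = \<delta> i + n i t x) \<and>
               (\<forall>t>0. \<forall>x. T t x = 1 + \<theta> t x) \<longrightarrow>
               perturbed_system N kB k \<epsilon> lam \<rho>0 c \<nu> z \<delta> n \<theta> m \<phi> (u 0) P))"
proof -
  have kB: "0 < kB" and \<epsilon>: "0 < \<epsilon>" and \<rho>0: "0 < \<rho>0"
    and c: "\<And>i. i \<in> {0..N} \<Longrightarrow> 0 < c i" and \<nu>: "\<And>i. i \<in> {1..N} \<Longrightarrow> 0 < \<nu> i"
    using assms(2) unfolding admissible_coefficients_def by auto
  have \<rho>: "0 < \<rho> i t x" if "i \<in> {1..N}" "0 < t" for i t x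
    using assms(5) that by blast
  have smooth_\<rho>: "twice_differentiable (\<rho> i t)"
    and \<rho>_t: "(\<lambda>s. \<rho> i s x) differentiable (at t)" if "i \<in> {1..N}" "0 < t" for i t x
    using assms(3) that unfolding sufficiently_smooth_def by blast+
  have smooth_T: "twice_differentiable (T t)" and T_t: "(\<lambda>s. T s x) differentiable (at t)"
    and smooth_\<phi>: "twice_differentiable (\<phi> t)" if "0 < t" for t x
    using assms(3) that unfolding sufficiently_smooth_def by blast+
  have smooth_u: "u i t differentiable (at x)" if "i \<le> N" "0 < t" for i t x
  proof (cases "i = 0")
    case True
    then show ?thesis
      using assms(3) that unfolding sufficiently_smooth_def
      by (blast intro: differentiable_componentwise twice_differentiableD)
  next
    case False
    then have "i \<in> {1..N}" using that by simp
    then show ?thesis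
      using assms(3) that unfolding sufficiently_smooth_def differentiable_on_def
      by simp
  qed
  have m_eq: "m t = (\<lambda>y. \<Sum>i=1..N. z i * \<rho> i t y)" if "0 < t" for t
    using assms(6) that by blast
  have m_t: "time_deriv m t x = (\<Sum>i=1..N. z i * time_deriv (\<rho> i) t x)" if t: "0 < t" for t x
    by (rule time_deriv_eqI[OF DERIV_sum[OF DERIV_cmult[OF has_time_deriv[OF \<rho>_t[OF _ t]]]] t])
      (simp_all add: m_eq)
  have equivalence: "pnpf_system N kB k \<epsilon> lam c \<nu> z \<rho> T \<phi> P u \<longleftrightarrow>
            friction_law N kB \<nu> z \<rho> T \<phi> u \<and> far_field \<phi> (u 0) \<and>
            reduced_system N kB k \<epsilon> lam c \<nu> z \<rho> T m \<phi> P (u 0)"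
  \<comment> \<open>Both sides contain the friction law, so they are false together when it fails;
    otherwise it may be used in both directions.\<close>
  proof (cases "friction_law N kB \<nu> z \<rho> T \<phi> u")
    case False
    then show ?thesis unfolding pnpf_system_def by blast
  next
    case True
    have law: "(\<nu> i * \<rho> i t y) *\<^sub>R (u i t y - u 0 t y) =
        - (kB *\<^sub>R grad (\<lambda>y. \<rho> i t y * T t y) y) - (z i * \<rho> i t y) *\<^sub>R grad (\<phi> t) y"
      if "i \<in> {1..N}" "0 < t" for i t y
      using True that unfolding friction_law_def by blast
    have mass: "time_deriv (\<rho> i) t x + divergence (\<lambda>y. \<rho> i t y *\<^sub>R u i t y) x = 0 \<longleftrightarrow>
        time_deriv (\<rho> i) t x + u 0 t x \<bullet> grad (\<rho> i t) x
         - kB / \<nu> i * laplacian (\<lambda>y. \<rho> i t y * T t y) x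
         - divergence (\<lambda>y. (z i / \<nu> i * \<rho> i t y) *\<^sub>R grad (\<phi> t) y) x = 0"
      if t: "0 < t" and i: "i \<in> {1..N}" and "divergence (u 0 t) x = 0" for i t x
    proof -
      have "\<nu> i \<noteq> 0" using \<nu>[OF i] by simp
      note flux = divergence_flux[OF law[OF i t] this smooth_\<rho>[OF i t] smooth_T[OF t]
          smooth_\<phi>[OF t] smooth_u[OF le0 t] that(3)]
      show ?thesis unfolding flux add_diff_eq ..
    qed
    have poisson: "- \<epsilon> * laplacian (\<phi> t) x = (\<Sum>j=1..N. z j * \<rho> j t x) \<longleftrightarrow>
        - laplacian (\<phi> t) x = 1 / \<epsilon> * m t x" if "0 < t" for t x
      unfolding m_eq[OF that] using \<epsilon> by (simp add: field_simps)
    have momentum: "(\<Sum>i=1..N. (\<nu> i * \<rho> i t x) *\<^sub>R (u 0 t x - u i t x)) =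
        (\<Sum>i=1..N. kB *\<^sub>R grad (\<lambda>y. \<rho> i t y * T t y) x) + m t x *\<^sub>R grad (\<phi> t) x"
      if "0 < t" for t x
      unfolding m_eq[OF that]
      by (rule momentum_source[where r="\<lambda>i. \<rho> i t" and u="\<lambda>i. u i t"])
        (use law \<nu> \<rho> that in blast)+
    have heat: "(\<Sum>i=0..N. kB * c i * \<rho> i t x) * time_deriv T t x
         + (\<Sum>i=0..N. (kB * c i * \<rho> i t x) *\<^sub>R u i t x) \<bullet> grad (T t) x
         + (\<Sum>i=1..N. kB * \<rho> i t x * divergence (u i t) x) * T t x
         = k * laplacian (T t) x + lam * grad_norm_sq (u 0 t) x
           + (\<Sum>i=1..N. \<nu> i * \<rho> i t x * (norm (u i t x - u 0 t x))\<^sup>2) \<longleftrightarrow>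
       (\<Sum>i=0..N. kB * c i * \<rho> i t x) * time_deriv T t x - k * laplacian (T t) x
       + (\<Sum>i=0..N. kB * c i * \<rho> i t x * (u 0 t x \<bullet> grad (T t) x))
       - (\<Sum>i=1..N. kB\<^sup>2 * c i / \<nu> i * (grad (\<lambda>y. \<rho> i t y * T t y) x \<bullet> grad (T t) x))
       = lam * grad_norm_sq (u 0 t) x
         + (\<Sum>i=1..N. 1 / (\<nu> i * \<rho> i t x) *
             (norm (kB *\<^sub>R grad (\<lambda>y. \<rho> i t y * T t y) x
                    + (z i * \<rho> i t x) *\<^sub>R grad (\<phi> t) x))\<^sup>2)
         + (\<Sum>i=1..N. kB * c i * z i / \<nu> i * \<rho> i t x * (grad (\<phi> t) x \<bullet> grad (T t) x))
         + (\<Sum>i=1..N. kB\<^sup>2 / \<nu> i * laplacian (\<lambda>y. \<rho> i t y * T t y) x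
             - kB\<^sup>2 / (\<nu> i * \<rho> i t x) * (grad (\<rho> i t) x \<bullet> grad (\<lambda>y. \<rho> i t y * T t y) x)
             - kB * z i / (\<epsilon> * \<nu> i) * \<rho> i t x * m t x) * T t x"
      if t: "0 < t" and "divergence (u 0 t) x = 0" "- laplacian (\<phi> t) x = 1 / \<epsilon> * m t x" for t x
    proof -
      have "laplacian (\<phi> t) x = - (m t x / \<epsilon>)" using that(3) by simp
      note work = compression_work[where r="\<lambda>i. \<rho> i t" and u="\<lambda>i. u i t",
          OF law[OF _ t] \<nu> \<rho>[OF _ t] smooth_\<rho>[OF _ t] smooth_T[OF t] smooth_\<phi>[OF t]
            smooth_u[OF _ t] that(2) this]
      note convection = heat_convection[where r="\<lambda>i. \<rho> i t" and u="\<lambda>i. u i t",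
          OF law[OF _ t] \<nu> \<rho>[OF _ t]]
      note heating = friction_heating[where r="\<lambda>i. \<rho> i t" and u="\<lambda>i. u i t",
          OF law[OF _ t] \<nu> \<rho>[OF _ t]]
      show ?thesis by (simp only: work convection heating mult_minus_left) linarith
    qed
    have charge: "time_deriv m t x + u 0 t x \<bullet> grad (m t) x
        - kB / mean_friction N \<nu> * laplacian (\<lambda>y. m t y * T t y) x
        = (\<Sum>i=1..N. (z i)\<^sup>2 / \<nu> i * divergence (\<lambda>y. \<rho> i t y *\<^sub>R grad (\<phi> t) y) x)
          + kB * (\<Sum>i=1..N. (1 / \<nu> i - 1 / mean_friction N \<nu>) * z i
                     * laplacian (\<lambda>y. \<rho> i t y * T t y) x)"
      if t: "0 < t" and eq: "\<forall>i\<in>{1..N}. time_deriv (\<rho> i) t x + u 0 t x \<bullet> grad (\<rho> i t) x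
         - kB / \<nu> i * laplacian (\<lambda>y. \<rho> i t y * T t y) x
         - divergence (\<lambda>y. (z i / \<nu> i * \<rho> i t y) *\<^sub>R grad (\<phi> t) y) x = 0" for t x
      unfolding m_t[OF t]
      by (rule charge_equation[OF bspec[OF eq] smooth_\<rho>[OF _ t] smooth_T[OF t] smooth_\<phi>[OF t]
            m_eq[OF t]])
    \<comment> \<open>The logical skeleton: A is mass, B Poisson, C heat, M momentum, D
      incompressibility, E charge, with primes for the reduced forms. It lets A use D, and C use D
      and B', although these stand elsewhere in the conjunctions, and it asks for E only as a
      consequence of A'.\<close>
    have pointwise: "(\<forall>t>0. \<forall>x. A t x \<and> B t x \<and> C t x \<and> M t x \<and> D t x) \<longleftrightarrow>
        (\<forall>t>0. \<forall>x. A' t x \<and> B' t x \<and> M' t x \<and> D t x \<and> C' t x \<and> E t x)"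
      if "\<And>t x. 0 < t \<Longrightarrow> D t x \<Longrightarrow> A t x \<longleftrightarrow> A' t x" "\<And>t x. 0 < t \<Longrightarrow> B t x \<longleftrightarrow> B' t x"
        "\<And>t x. 0 < t \<Longrightarrow> M t x \<longleftrightarrow> M' t x"
        "\<And>t x. 0 < t \<Longrightarrow> D t x \<Longrightarrow> B' t x \<Longrightarrow> C t x \<longleftrightarrow> C' t x"
        "\<And>t x. 0 < t \<Longrightarrow> A' t x \<Longrightarrow> E t x"
      for A A' B B' C C' D E M M' :: "real \<Rightarrow> real ^ 3 \<Rightarrow> bool"
      using that by blast
    show ?thesis
      unfolding pnpf_system_def reduced_system_def
    proof (intro conj_cong refl, rule pointwise, goal_cases)
      case 1
      then show ?case by (intro ball_cong refl mass)
    next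
      case 2
      then show ?case by (intro poisson)
    next
      case 3
      then show ?case by (simp only: momentum add.assoc)
    next
      case 4
      then show ?case by (intro heat)
    next
      case 5
      then show ?case by (intro charge)
    qed
  qed
  moreover have "perturbed_system N kB k \<epsilon> lam \<rho>0 c \<nu> z \<delta> n \<theta> m \<phi> (u 0) P"
    if reduced: "reduced_system N kB k \<epsilon> lam c \<nu> z \<rho> T m \<phi> P (u 0)"
      and \<delta>: "(\<Sum>j=1..N. z j * \<delta> j) = 0"
      and n: "\<forall>i\<in>{1..N}. \<forall>t>0. \<forall>x. \<rho> i t x = \<delta> i + n i t x"
      and \<theta>: "\<forall>t>0. \<forall>x. T t x = 1 + \<theta> t x"
    for \<delta> :: "nat \<Rightarrow> real" and n :: "nat \<Rightarrow> real \<Rightarrow> real ^ 3 \<Rightarrow> real"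
      and \<theta> :: "real \<Rightarrow> real ^ 3 \<Rightarrow> real"
    unfolding perturbed_system_def
  proof (intro allI impI)
    fix t :: real and x
    assume t: "0 < t"
    have \<rho>_eq: "\<rho> i t = (\<lambda>y. \<delta> i + n i t y)" if "i \<in> {1..N}" for i
      using n that t by blast
    have T_eq: "T t = (\<lambda>y. 1 + \<theta> t y)"
      using \<theta> t by blast
    \<comment> \<open>The perturbations carry no regularity assumption of their own. They inherit it
      from the density, here written as a sum with the constant \<open>- \<delta> i\<close>.\<close>
    have "n i t = (\<lambda>y. - \<delta> i + \<rho> i t y)" if "i \<in> {1..N}" for i
      using \<rho>_eq[OF that] by simp
    then have smooth_n: "twice_differentiable (n i t)" if "i \<in> {1..N}" for i
      using that smooth_\<rho>[OF _ t]
      by (simp only: twice_differentiable_add twice_differentiable_const)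
    have "\<theta> t = (\<lambda>y. - 1 + T t y)"
      using T_eq by simp
    then have smooth_\<theta>: "twice_differentiable (\<theta> t)"
      using smooth_T[OF t]
      by (simp only: twice_differentiable_add twice_differentiable_const)
    have n_t: "time_deriv (n i) t x = time_deriv (\<rho> i) t x" if i: "i \<in> {1..N}" for i
    proof -
      have "((\<lambda>s. \<rho> i s x - \<delta> i) has_field_derivative time_deriv (\<rho> i) t x) (at t)"
        using DERIV_diff[OF has_time_deriv[OF \<rho>_t[OF i t]] DERIV_const] by simp
      then show ?thesis
        by (rule time_deriv_eqI[where g="\<lambda>s y. \<rho> i s y - \<delta> i"]) (use n i t in auto)
    qed
    have \<theta>_t: "time_deriv \<theta> t x = time_deriv T t x"
    proof -
      have "((\<lambda>s. T s x - 1) has_field_derivative time_deriv T t x) (at t)"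
        using DERIV_diff[OF has_time_deriv[OF T_t[OF t]] DERIV_const] by simp
      then show ?thesis
        by (rule time_deriv_eqI[where g="\<lambda>s y. T s y - 1"]) (use \<theta> t in auto)
    qed
    have m_n: "m t = (\<lambda>y. \<Sum>i=1..N. z i * n i t y)"
    proof
      fix y
      have "m t y = (\<Sum>i=1..N. z i * (\<delta> i + n i t y))"
        unfolding m_eq[OF t] by (intro sum.cong refl) (simp only: \<rho>_eq)
      \<comment> \<open>The constant part of the charge vanishes by neutrality of the
        \<delta>-values.\<close>
      then show "m t y = (\<Sum>i=1..N. z i * n i t y)"
        using \<delta> by (simp add: distrib_left sum.distrib)
    qed
    note eqs = reduced[unfolded reduced_system_def, rule_format, OF t, of x]
    have poisson: "laplacian (\<phi> t) x = - (m t x / \<epsilon>)"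
      using eqs by simp
    note slices = \<rho>_eq T_eq smooth_n smooth_\<theta> smooth_\<phi>[OF t] poisson
    have density: "time_deriv (n i) t x - kB / \<nu> i * laplacian (n i t) x
         = kB * \<delta> i / \<nu> i * laplacian (\<theta> t) x + z i * \<delta> i / \<nu> i * laplacian (\<phi> t) x
           + R_n kB \<epsilon> \<nu> z i (\<lambda>j. n j t) (\<theta> t) (m t) (\<phi> t) (u 0 t) x"
      if i: "i \<in> {1..N}" for i
      unfolding n_t[OF i]
      by (rule perturbed_density_equation[where r="\<lambda>i. \<rho> i t" and n="\<lambda>i. n i t" and m="m t" and x=x, OF slices i])
        (use eqs i in blast)+
    have source: "(\<Sum>i=1..N. kB *\<^sub>R grad (\<lambda>y. \<rho> i t y * T t y) x) + m t x *\<^sub>R grad (\<phi> t) x =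
        (\<Sum>i=1..N. kB *\<^sub>R grad (\<lambda>y. n i t y + \<delta> i * \<theta> t y) x)
          + R_u N kB (\<lambda>j. n j t) (\<theta> t) (m t) (\<phi> t) x"
      by (rule perturbed_momentum_source[where r="\<lambda>i. \<rho> i t" and n="\<lambda>i. n i t" and m="m t" and x=x, OF slices])
    have m_t': "time_deriv m t x = (\<Sum>i=1..N. z i * time_deriv (n i) t x)"
      unfolding m_t[OF t] by (intro sum.cong refl) (simp only: n_t)
    define A where "A = (\<Sum>i=0..N. kB * c i * \<rho> i t x)"
    \<comment> \<open>The solvent density is the constant \<rho>0, so index 0 contributes only to
      the constant part \<open>coeff_a\<close>.\<close>
    have A_eq: "A = coeff_a N kB \<rho>0 c \<delta> + (\<Sum>i=1..N. kB * c i * n i t x)"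
    proof -
      have "A = kB * c 0 * \<rho> 0 t x + (\<Sum>i=1..N. kB * c i * \<rho> i t x)"
        unfolding A_def by (simp add: sum.atLeast_Suc_atMost)
      also have "(\<Sum>i=1..N. kB * c i * \<rho> i t x) = (\<Sum>i=1..N. kB * c i * (\<delta> i + n i t x))"
        by (intro sum.cong refl) (simp only: \<rho>_eq)
      finally show ?thesis
        using assms(4) t by (simp add: coeff_a_def distrib_left sum.distrib)
    qed
    \<comment> \<open>Positivity of every density, the solvent included, is what permits the
      division by the heat capacity.\<close>
    have "0 < A"
      unfolding A_def
    proof (rule sum_pos)
      fix i assume "i \<in> {0..N}"
      moreover have "0 < \<rho> i t x"
        using assms(4) \<rho>0 t \<rho>[of i t x] \<open>i \<in> {0..N}\<close> by (cases "i = 0") auto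
      ultimately show "0 < kB * c i * \<rho> i t x"
        using kB c by simp
    qed simp_all
    then have "A \<noteq> 0" by simp
    have "(\<Sum>i=0..N. kB * c i * \<rho> i t x * (u 0 t x \<bullet> grad (T t) x)) =
        A * (u 0 t x \<bullet> grad (T t) x)"
      unfolding A_def sum_distrib_right ..
    with eqs \<theta>_t A_def have heat: "A * time_deriv \<theta> t x - k * laplacian (T t) x
      + A * (u 0 t x \<bullet> grad (T t) x)
      - (\<Sum>i=1..N. kB\<^sup>2 * c i / \<nu> i * (grad (\<lambda>y. \<rho> i t y * T t y) x \<bullet> grad (T t) x))
      = lam * grad_norm_sq (u 0 t) x
         + (\<Sum>i=1..N. 1 / (\<nu> i * \<rho> i t x) *
             (norm (kB *\<^sub>R grad (\<lambda>y. \<rho> i t y * T t y) x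
                    + (z i * \<rho> i t x) *\<^sub>R grad (\<phi> t) x))\<^sup>2)
         + (\<Sum>i=1..N. kB * c i * z i / \<nu> i * \<rho> i t x * (grad (\<phi> t) x \<bullet> grad (T t) x))
         + (\<Sum>i=1..N. kB\<^sup>2 / \<nu> i * laplacian (\<lambda>y. \<rho> i t y * T t y) x
             - kB\<^sup>2 / (\<nu> i * \<rho> i t x) * (grad (\<rho> i t) x \<bullet> grad (\<lambda>y. \<rho> i t y * T t y) x)
             - kB * z i / (\<epsilon> * \<nu> i) * \<rho> i t x * m t x) * T t x"
      by (simp only:)
    show "(\<forall>i\<in>{1..N}.
       time_deriv (n i) t x - kB / \<nu> i * laplacian (n i t) x
         = kB * \<delta> i / \<nu> i * laplacian (\<theta> t) x + z i * \<delta> i / \<nu> i * laplacian (\<phi> t) x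
           + R_n kB \<epsilon> \<nu> z i (\<lambda>j. n j t) (\<theta> t) (m t) (\<phi> t) (u 0 t) x) \<and>
     - laplacian (\<phi> t) x = 1 / \<epsilon> * m t x \<and>
     lam *\<^sub>R vec_laplacian (u 0 t) x
       = grad (P t) x + (\<Sum>i=1..N. kB *\<^sub>R grad (\<lambda>y. n i t y + \<delta> i * \<theta> t y) x)
         + R_u N kB (\<lambda>j. n j t) (\<theta> t) (m t) (\<phi> t) x \<and>
     divergence (u 0 t) x = 0 \<and>
     coeff_a N kB \<rho>0 c \<delta> * time_deriv \<theta> t x - coeff_b N kB k \<nu> \<delta> * laplacian (\<theta> t) x
       = (\<Sum>i=1..N. kB\<^sup>2 / \<nu> i * laplacian (n i t) x)
         + (\<Sum>i=1..N. kB * z i * \<delta> i / \<nu> i * laplacian (\<phi> t) x)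
         + R_theta N kB k \<epsilon> lam \<rho>0 c \<nu> z \<delta> (\<lambda>j. n j t) (\<theta> t) (m t) (\<phi> t) (u 0 t) x \<and>
     time_deriv m t x - kB / mean_friction N \<nu> * laplacian (m t) x
       + 1 / \<epsilon> * (\<Sum>i=1..N. (z i)\<^sup>2 * \<delta> i / \<nu> i) * m t x
       = kB * (\<Sum>i=1..N. (1 / \<nu> i - 1 / mean_friction N \<nu>) * z i * laplacian (n i t) x)
         + kB * (\<Sum>i=1..N. z i * \<delta> i / \<nu> i * laplacian (\<theta> t) x)
         + R_m N kB \<epsilon> \<nu> z (\<lambda>j. n j t) (\<theta> t) (m t) (\<phi> t) (u 0 t) x"
    proof (intro conjI ballI, goal_cases)
      case (1 i)
      then show ?case by (rule density)
    next
      case 2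
      show ?case using eqs by blast
    next
      case 3
      have "lam *\<^sub>R vec_laplacian (u 0 t) x
         = grad (P t) x + (\<Sum>i=1..N. kB *\<^sub>R grad (\<lambda>y. \<rho> i t y * T t y) x)
           + m t x *\<^sub>R grad (\<phi> t) x"
        using eqs by blast
      then show ?case by (simp only: add.assoc source)
    next
      case 4
      show ?case using eqs by blast
    next
      case 5
      show ?case
        by (rule perturbed_heat_equation[where r="\<lambda>i. \<rho> i t" and n="\<lambda>i. n i t" and m="m t" and x=x,
              OF slices heat A_eq \<open>A \<noteq> 0\<close>])
    next
      case 6
      show ?case
        unfolding m_t'
        by (rule perturbed_charge_equation[where r="\<lambda>i. \<rho> i t" and n="\<lambda>i. n i t" and m="m t" and x=x,
              OF slices density m_n])
    qed
  qed
  ultimately show ?thesis by blast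
qed

end
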